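(* Let $g\geq 3$. Let $\omega=\phi((a_1\wedge b_1)^2)$ and $\tilde\omega=\phi((a_g\wedge b_g)^2)$, which lie in $\mathrm{Der}_2\mathfrak{p}$, and write $\omega=\xi_{[2^2]}+\xi_{[1^2]}$ and $\tilde\omega=\tilde\xi_{[2^2]}+\tilde\xi_{[1^2]}$ according to the $\mathrm{Sp}(H)$-decomposition $\mathrm{Der}_2\mathfrak{p}=V_{[2^2]}\oplus V_{[1^2]}$. Then $[\xi_{[2^2]},\tilde\xi_{[2^2]}]$ is a nontrivial inner derivation in $\mathrm{Der}_4\mathfrak{p}$.
   Context: $H$ is a $2g$-dimensional $\mathbb{Q}$-vector space with symplectic basis $a_1,b_1,\dots,a_g,b_g$ and symplectic form $\theta$ (with $\theta=\sum a_i\wedge b_i$). $\mathfrak{p}=\bigoplus_m\mathfrak{p}(m)=\mathbb{L}(H)/(\sum_i[a_i,b_i])$, the free Lie algebra on $H$ modulo the ideal generated by $\sum_i[a_i,b_i]$, graded by bracket length. $\phi:\mathrm{Sym}^2\Lambda^2H\to\mathrm{Hom}(H,\mathfrak{p}(3))$ sends $(u_1\wedge v_1)(u_2\wedge v_2)$ to $x\mapsto \theta(u_1,x)[v_1,[u_2,v_2]]-\theta(v_1,x)[u_1,[u_2,v_2]]+\theta(u_2,x)[v_2,[u_1,v_1]]-\theta(v_2,x)[u_2,[u_1,v_1]]$. $\mathrm{Der}_n\mathfrak{p}$ denotes the degree-$n$ derivations of $\mathfrak{p}$ (determined by their restriction $\mathfrak{p}(1)\to\mathfrak{p}(n+1)$),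 and $\mathrm{Der}\mathfrak{p}=\bigoplus_n\mathrm{Der}_n\mathfrak{p}$ is a graded Lie algebra under commutator. For $g\ge 3$, $\mathrm{Der}_2\mathfrak{p}\cong V_{[2^2]}\oplus V_{[1^2]}$ as $\mathrm{Sp}(H)$-modules, where $V_\lambda$ is the irreducible $\mathrm{Sp}(H)$-representation with highest weight given by the partition $\lambda$. A derivation is inner if it equals $\mathrm{ad}(y)$ for some $y\in\mathfrak{p}$. *)

theory Defs
  imports Complex_Main
begin

datatype gen = A nat | B nat

definition gens :: "nat \<Rightarrow> gen set" where
  "gens g = {A i | i. 1 \<le> i \<and> i \<le> g} \<union> {B i | i. 1 \<le> i \<and> i \<le> g}"

text \<open>Elements of the tensor algebra T(H) = Q<a_1,b_1,...>: coefficient functions on words.\<close>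
type_synonym tens = "gen list \<Rightarrow> rat"

definition tzero :: tens where "tzero = (\<lambda>w. 0)"
definition tadd :: "tens \<Rightarrow> tens \<Rightarrow> tens" where "tadd u v = (\<lambda>w. u w + v w)"
definition tsub :: "tens \<Rightarrow> tens \<Rightarrow> tens" where "tsub u v = (\<lambda>w. u w - v w)"
definition tsmul :: "rat \<Rightarrow> tens \<Rightarrow> tens" where "tsmul c u = (\<lambda>w. c * u w)"
definition tmul :: "tens \<Rightarrow> tens \<Rightarrow> tens" where
  "tmul u v = (\<lambda>w. \<Sum>k\<le>length w. u (take k w) * v (drop k w))"
definition tbr :: "tens \<Rightarrow> tens \<Rightarrow> tens" where
  "tbr u v = tsub (tmul u v) (tmul v u)"
definition tgen :: "gen \<Rightarrow> tens" where
  "tgen x = (\<lambda>w. if w = [x] then 1 else 0)"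

definition omega_rel :: "nat \<Rightarrow> tens" where
  "omega_rel g = (\<lambda>w. \<Sum>i\<in>{1..g}. tbr (tgen (A i)) (tgen (B i)) w)"

section \<open>Free Lie algebra L(H) (as Lie subalgebra of T(H)), the ideal, and p = L(H)/ideal\<close>

inductive LieP :: "nat \<Rightarrow> nat \<Rightarrow> tens \<Rightarrow> bool" for g where
  gen: "x \<in> gens g \<Longrightarrow> LieP g 1 (tgen x)"
| zero: "LieP g m tzero"
| add: "LieP g m u \<Longrightarrow> LieP g m v \<Longrightarrow> LieP g m (tadd u v)"
| smul: "LieP g m u \<Longrightarrow> LieP g m (tsmul c u)"
| br: "LieP g m u \<Longrightarrow> LieP g n v \<Longrightarrow> LieP g (m + n) (tbr u v)"

inductive IdealP :: "nat \<Rightarrow> nat \<Rightarrow> tens \<Rightarrow> bool" for g where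
  rel: "IdealP g 2 (omega_rel g)"
| zero: "IdealP g m tzero"
| add: "IdealP g m u \<Longrightarrow> IdealP g m v \<Longrightarrow> IdealP g m (tadd u v)"
| smul: "IdealP g m u \<Longrightarrow> IdealP g m (tsmul c u)"
| br: "LieP g m u \<Longrightarrow> IdealP g n v \<Longrightarrow> IdealP g (m + n) (tbr u v)"

text \<open>p(m) = LieP g m modulo IdealP g m; two representatives are equal in p(m) iff their
  difference lies in IdealP g m.\<close>

text \<open>A derivation of degree n is given by its values on the basis of H (representatives in
  L(H)_(n+1)).  dext extends f :: gen => tens to the derivation of T(H), which restricts to
  the Lie derivation of L(H).\<close>
definition dext :: "nat \<Rightarrow> (gen \<Rightarrow> tens) \<Rightarrow> tens \<Rightarrow> tens" where
  "dext g f u = (\<lambda>v. sum (\<lambda>(p, s, q). \<Sum>x\<in>gens g. u (p @ [x] @ q) * f x s)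
                        {(p, s, q). p @ s @ q = v})"

text \<open>f defines an element of Der_n p: values in L_(n+1) and the induced derivation of L(H)
  preserves the ideal (equivalently maps sum_i [a_i,b_i] into it).\<close>
definition IsDer :: "nat \<Rightarrow> nat \<Rightarrow> (gen \<Rightarrow> tens) \<Rightarrow> bool" where
  "IsDer g n f \<longleftrightarrow> (\<forall>x\<in>gens g. LieP g (n + 1) (f x)) \<and> IdealP g (n + 2) (dext g f (omega_rel g))"

definition deq :: "nat \<Rightarrow> nat \<Rightarrow> (gen \<Rightarrow> tens) \<Rightarrow> (gen \<Rightarrow> tens) \<Rightarrow> bool" where
  "deq g n f f' \<longleftrightarrow> (\<forall>x\<in>gens g. IdealP g (n + 1) (tsub (f x) (f' x)))"

definition dnull :: "nat \<Rightarrow> nat \<Rightarrow> (gen \<Rightarrow> tens) \<Rightarrow> bool" where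
  "dnull g n f \<longleftrightarrow> deq g n f (\<lambda>_. tzero)"

definition dadd :: "(gen \<Rightarrow> tens) \<Rightarrow> (gen \<Rightarrow> tens) \<Rightarrow> (gen \<Rightarrow> tens)" where
  "dadd f f' = (\<lambda>x. tadd (f x) (f' x))"

definition dsmul :: "rat \<Rightarrow> (gen \<Rightarrow> tens) \<Rightarrow> (gen \<Rightarrow> tens)" where
  "dsmul c f = (\<lambda>x. tsmul c (f x))"

definition der_br :: "nat \<Rightarrow> (gen \<Rightarrow> tens) \<Rightarrow> (gen \<Rightarrow> tens) \<Rightarrow> (gen \<Rightarrow> tens)" where
  "der_br g f1 f2 = (\<lambda>x. tsub (dext g f1 (f2 x)) (dext g f2 (f1 x)))"

definition inner_der :: "nat \<Rightarrow> nat \<Rightarrow> (gen \<Rightarrow> tens) \<Rightarrow> bool" where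
  "inner_der g n f \<longleftrightarrow> (\<exists>y. LieP g n y \<and> deq g n f (\<lambda>x. tbr y (tgen x)))"

definition theta :: "gen \<Rightarrow> gen \<Rightarrow> rat" where
  "theta x y = (case (x, y) of
      (A i, B j) \<Rightarrow> (if i = j then 1 else 0)
    | (B i, A j) \<Rightarrow> (if i = j then -1 else 0)
    | _ \<Rightarrow> 0)"

text \<open>phi((u1 wedge v1)(u2 wedge v2)) for basis vectors u1,v1,u2,v2.\<close>
definition phi :: "gen \<Rightarrow> gen \<Rightarrow> gen \<Rightarrow> gen \<Rightarrow> (gen \<Rightarrow> tens)" where
  "phi u1 v1 u2 v2 = (\<lambda>x w.
       theta u1 x * tbr (tgen v1) (tbr (tgen u2) (tgen v2)) w
     - theta v1 x * tbr (tgen u1) (tbr (tgen u2) (tgen v2)) w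
     + theta u2 x * tbr (tgen v2) (tbr (tgen u1) (tgen v1)) w
     - theta v2 x * tbr (tgen u2) (tbr (tgen u1) (tgen v1)) w)"

type_synonym hvec = "gen \<Rightarrow> rat"

definition thetaH :: "nat \<Rightarrow> hvec \<Rightarrow> hvec \<Rightarrow> rat" where
  "thetaH g h k = (\<Sum>i\<in>{1..g}. h (A i) * k (B i) - h (B i) * k (A i))"

text \<open>M x is the coordinate vector of the image of the basis vector x.\<close>
definition Sp :: "nat \<Rightarrow> (gen \<Rightarrow> hvec) set" where
  "Sp g = {M. (\<forall>x\<in>gens g. \<forall>y. y \<notin> gens g \<longrightarrow> M x y = 0) \<and>
              (\<forall>x\<in>gens g. \<forall>y\<in>gens g. thetaH g (M x) (M y) = theta x y)}"

text \<open>The induced algebra automorphism of T(H).\<close>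
definition Mhat :: "nat \<Rightarrow> (gen \<Rightarrow> hvec) \<Rightarrow> tens \<Rightarrow> tens" where
  "Mhat g M u = (\<lambda>v. \<Sum>w\<in>{w. length w = length v \<and> set w \<subseteq> gens g}.
                        u w * (\<Prod>i<length v. M (w ! i) (v ! i)))"

definition dlin :: "nat \<Rightarrow> (gen \<Rightarrow> tens) \<Rightarrow> hvec \<Rightarrow> tens" where
  "dlin g E h = (\<lambda>w. \<Sum>y\<in>gens g. h y * E y w)"

text \<open>sp_image g n M D E: E = M . D = M o D o M^-1 in Der_n p, i.e. E (M x) = M (D x).\<close>
definition sp_image :: "nat \<Rightarrow> nat \<Rightarrow> (gen \<Rightarrow> hvec) \<Rightarrow> (gen \<Rightarrow> tens) \<Rightarrow> (gen \<Rightarrow> tens) \<Rightarrow> bool" where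
  "sp_image g n M D E \<longleftrightarrow>
     (\<forall>x\<in>gens g. IdealP g (n + 1) (tsub (dlin g E (M x)) (Mhat g M (D x))))"

definition submod :: "nat \<Rightarrow> nat \<Rightarrow> (gen \<Rightarrow> tens) set \<Rightarrow> bool" where
  "submod g n U \<longleftrightarrow>
     (\<forall>f\<in>U. IsDer g n f) \<and>
     (\<forall>f\<in>U. \<forall>f'. IsDer g n f' \<and> deq g n f f' \<longrightarrow> f' \<in> U) \<and>
     (\<lambda>_. tzero) \<in> U \<and>
     (\<forall>f\<in>U. \<forall>f'\<in>U. dadd f f' \<in> U) \<and>
     (\<forall>c. \<forall>f\<in>U. dsmul c f \<in> U) \<and>
     (\<forall>M\<in>Sp g. \<forall>D\<in>U. \<exists>E\<in>U. sp_image g n M D E)"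

definition irred :: "nat \<Rightarrow> nat \<Rightarrow> (gen \<Rightarrow> tens) set \<Rightarrow> bool" where
  "irred g n U \<longleftrightarrow> submod g n U \<and> (\<exists>f\<in>U. \<not> dnull g n f) \<and>
     (\<forall>W. submod g n W \<and> W \<subseteq> U \<longrightarrow> (\<forall>f\<in>W. dnull g n f) \<or> W = U)"

text \<open>Diagonal maximal torus: a_i -> t_i a_i, b_i -> t_i^-1 b_i (so a_i has weight e_i).\<close>
definition torus :: "(nat \<Rightarrow> rat) \<Rightarrow> (gen \<Rightarrow> hvec)" where
  "torus t = (\<lambda>x y. case x of
      A i \<Rightarrow> (if y = A i then t i else 0)
    | B i \<Rightarrow> (if y = B i then inverse (t i) else 0))"

definition character :: "nat \<Rightarrow> (nat \<Rightarrow> int) \<Rightarrow> (nat \<Rightarrow> rat) \<Rightarrow> rat" where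
  "character g \<mu> t = (\<Prod>i\<in>{1..g}. power_int (t i) (\<mu> i))"

definition is_weight :: "nat \<Rightarrow> nat \<Rightarrow> (gen \<Rightarrow> tens) set \<Rightarrow> (nat \<Rightarrow> int) \<Rightarrow> bool" where
  "is_weight g n U \<mu> \<longleftrightarrow> (\<exists>D\<in>U. \<not> dnull g n D \<and>
     (\<forall>t. (\<forall>i\<in>{1..g}. t i \<noteq> 0) \<longrightarrow> sp_image g n (torus t) D (dsmul (character g \<mu> t) D)))"

text \<open>mu <= lambda in the dominance order of type C_g: lambda - mu is a nonnegative integer
  combination of the simple roots e_i - e_(i+1) (i < g) and 2 e_g.\<close>
definition dominated :: "nat \<Rightarrow> (nat \<Rightarrow> int) \<Rightarrow> (nat \<Rightarrow> int) \<Rightarrow> bool" where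
  "dominated g \<mu> lam \<longleftrightarrow> (\<exists>c :: nat \<Rightarrow> nat. \<forall>k\<in>{1..g}.
     lam k - \<mu> k = (if k < g then int (c k) else 2 * int (c g)) - (if 1 < k then int (c (k - 1)) else 0))"

text \<open>U is an irreducible submodule isomorphic to V_lambda.\<close>
definition highest_weight :: "nat \<Rightarrow> nat \<Rightarrow> (gen \<Rightarrow> tens) set \<Rightarrow> (nat \<Rightarrow> int) \<Rightarrow> bool" where
  "highest_weight g n U lam \<longleftrightarrow> irred g n U \<and> is_weight g n U lam \<and>
     (\<forall>\<mu>. is_weight g n U \<mu> \<longrightarrow> dominated g \<mu> lam)"

definition lam22 :: "nat \<Rightarrow> int" where "lam22 = (\<lambda>i. if i = 1 \<or> i = 2 then 2 else 0)"
definition lam11 :: "nat \<Rightarrow> int" where "lam11 = (\<lambda>i. if i = 1 \<or> i = 2 then 1 else 0)"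

end

theory Submission
  imports Defs "HOL-Library.Function_Algebras" "Jordan_Normal_Form.Determinant"
begin

text \<open>Write \<open>w\<^sub>k = [a\<^sub>k, b\<^sub>k]\<close> and \<open>\<omega>\<^sub>k = \<phi>((a\<^sub>k \<and> b\<^sub>k)\<^sup>2)\<close>. The inner derivations of degree 2 form
  the summand \<open>V\<^bsub>[1\<^sup>2]\<^esub>\<close>, so \<open>\<xi>\<^bsub>[2\<^sup>2]\<^esub> = \<omega>\<^sub>1 - ad y\<close> for some \<open>y\<close>. As \<open>\<omega>\<^sub>1\<close> is fixed by the symplectic
  maps fixing \<open>a\<^sub>1\<close> and \<open>b\<^sub>1\<close>, so is \<open>y\<close>, whence \<open>y = c w\<^sub>1\<close>. Here \<open>c\<close> is not 0: the orbit of \<open>\<omega>\<^sub>1\<close> spans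
  \<open>\<phi>((a\<^sub>1 \<and> b\<^sub>1) \<theta>) = - ad w\<^sub>1\<close>, so \<open>\<omega>\<^sub>1\<close> is not in \<open>V\<^bsub>[2\<^sup>2]\<^esub>\<close>. The derivations \<open>\<omega>\<^sub>1\<close> and \<open>\<omega>\<^sub>g\<close> act on different
  handles and kill every \<open>w\<^sub>k\<close>, so the bracket of \<open>\<omega>\<^sub>1 - c ad w\<^sub>1\<close> and \<open>\<omega>\<^sub>g - c' ad w\<^sub>g\<close> is
  \<open>c c' ad [w\<^sub>1, w\<^sub>g]\<close>. This is nonzero because it survives in a free Lie algebra quotient.\<close>

text \<open>Everything happens in p, but only representatives in L(H) modulo the ideal and two
  abstract submodules \<open>U1\<close>, \<open>U2\<close> are given, with no explicit projectors.
  Each representation-theoretic step therefore combines irreducibility (a submodule is null or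
  everything) with a few explicit symplectic maps. Invariance of y is obtained only up to multiples
  of the full relation w_1 + ... + w_g, since exactly these act as zero in degree 2; finding this
  kernel requires the ideal in degree 3. The orbit of omega_1 consists of values of phi on squares
  of decomposable bivectors. Polarizing them gives sums of two products, and the Jacobi identity
  separates the wanted product of a_k wedge b_k with a_i wedge b_i. The constants c and c' are never
  evaluated; their nonvanishing is enough. Three handles matter at the end: for g = 2 the relation
  reads w_2 = - w_1 in p, so [w_1, w_g] vanishes, whereas for g >= 3 another handle can absorb the
  relation while w_1 and w_g stay independent.\<close>

text \<open>\<open>induction\<close> yields eta-expanded goals; the pointwise rules would then destroy the
  group operations on tensors.\<close>
lemmas fun_applies = plus_fun_apply zero_fun_apply minus_apply uminus_apply
declare fun_applies [simp del]

lemma tens_simps [simp]: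
  "tadd u v = u + v" "tsub u v = u - v" "tzero = 0"
  by (auto simp: tadd_def tsub_def tzero_def fun_eq_iff fun_applies)

lemma der_simps [simp]: "dadd f f' = f + f'" "(\<lambda>_. 0 :: tens) = (0 :: gen \<Rightarrow> tens)"
  by (auto simp: dadd_def fun_eq_iff fun_applies)

lemma sum_fun_apply: "(\<Sum>i\<in>S. f i) x = (\<Sum>i\<in>S. f i x)" for f :: "_ \<Rightarrow> _ \<Rightarrow> _ :: comm_monoid_add"
  by (induction S rule: infinite_finite_induct) (auto simp: fun_applies)

lemma finite_gens [simp]: "finite (gens g)"
  by (simp add: gens_def)

lemma gens_iff [simp]: "A i \<in> gens g \<longleftrightarrow> i \<in> {1..g}" "B i \<in> gens g \<longleftrightarrow> i \<in> {1..g}"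
  by (auto simp: gens_def)

lemma sum_gens:
  fixes f :: "gen \<Rightarrow> 'a :: comm_monoid_add"
  shows "(\<Sum>x\<in>gens g. f x) = (\<Sum>i\<in>{1..g}. f (A i) + f (B i))"
proof -
  have "gens g = A ` {1..g} \<union> B ` {1..g}"
    by (auto simp: gens_def)
  moreover have "A ` {1..g} \<inter> B ` {1..g} = {}"
    by auto
  ultimately have "sum f (gens g) = sum f (A ` {1..g}) + sum f (B ` {1..g})"
    by (simp add: sum.union_disjoint)
  then show ?thesis
    by (simp add: sum.reindex inj_on_def sum.distrib)
qed

subsection \<open>Linearity\<close>

lemma tmul_linear:
  "tmul (u + u') v = tmul u v + tmul u' v" "tmul u (v + v') = tmul u v + tmul u v'"
  "tmul (u - u') v = tmul u v - tmul u' v" "tmul u (v - v') = tmul u v - tmul u v'"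
  "tmul (tsmul c u) v = tsmul c (tmul u v)" "tmul u (tsmul c v) = tsmul c (tmul u v)"
  "tmul (- u) v = - tmul u v" "tmul u (- v) = - tmul u v"
  by (auto simp: tmul_def fun_eq_iff fun_applies tsmul_def algebra_simps sum.distrib sum_subtractf
      sum_distrib_left sum_negf)

lemma tmul_zero [simp]: "tmul 0 v = 0" "tmul u 0 = 0"
  by (auto simp: tmul_def fun_eq_iff fun_applies)

lemma tsmul_linear:
  "tsmul c (u + v) = tsmul c u + tsmul c v" "tsmul c (u - v) = tsmul c u - tsmul c v"
  "tsmul c (- u) = - tsmul c u" "tsmul (c + d) u = tsmul c u + tsmul d u"
  "tsmul (c - d) u = tsmul c u - tsmul d u" "tsmul c (tsmul d u) = tsmul (c * d) u"
  by (auto simp: tsmul_def fun_eq_iff fun_applies algebra_simps)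

lemma tsmul_simps [simp]: "tsmul c 0 = 0" "tsmul 0 u = 0" "tsmul 1 u = u" "tsmul (-1) u = - u"
  "tsmul (- c) u = - tsmul c u"
  by (auto simp: tsmul_def fun_eq_iff fun_applies)

lemma tsmul_sum: "tsmul c (\<Sum>i\<in>S. f i) = (\<Sum>i\<in>S. tsmul c (f i))"
  by (auto simp: tsmul_def fun_eq_iff fun_applies sum_fun_apply sum_distrib_left)

lemma tbr_linear:
  "tbr (u + u') v = tbr u v + tbr u' v" "tbr u (v + v') = tbr u v + tbr u v'"
  "tbr (u - u') v = tbr u v - tbr u' v" "tbr u (v - v') = tbr u v - tbr u v'"
  "tbr (tsmul c u) v = tsmul c (tbr u v)" "tbr u (tsmul c v) = tsmul c (tbr u v)"
  "tbr (- u) v = - tbr u v" "tbr u (- v) = - tbr u v"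
  by (auto simp: tbr_def tmul_linear tsmul_linear algebra_simps)

lemma tbr_zero [simp]: "tbr 0 v = 0" "tbr u 0 = 0"
  by (auto simp: tbr_def)

lemma tbr_sum: "tbr (\<Sum>i\<in>S. f i) v = (\<Sum>i\<in>S. tbr (f i) v)" "tbr u (\<Sum>i\<in>S. f i) = (\<Sum>i\<in>S. tbr u (f i))"
  by (induction S rule: infinite_finite_induct) (auto simp: tbr_linear)

lemma tbr_swap: "tbr v u = - tbr u v"
  by (simp add: tbr_def)

lemma tbr_self [simp]: "tbr u u = 0"
  by (simp add: tbr_def)

lemma tmul_assoc: "tmul (tmul u v) w = tmul u (tmul v w)"
proof
  fix x :: "gen list"
  let ?n = "length x"
  have "tmul (tmul u v) w x =
     (\<Sum>k\<le>?n. \<Sum>j\<le>k. u (take j x) * v (drop j (take k x)) * w (drop k x))"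
    unfolding tmul_def
    by (rule sum.cong) (auto simp: sum_distrib_right min_def intro!: sum.cong)
  also have "\<dots> = (\<Sum>(k, j)\<in>(SIGMA k:{..?n}. {..k}). u (take j x) * v (drop j (take k x)) * w (drop k x))"
    by (simp add: sum.Sigma)
  also have "\<dots> = (\<Sum>(j, i)\<in>(SIGMA j:{..?n}. {..?n - j}).
      u (take j x) * v (take i (drop j x)) * w (drop i (drop j x)))"
    by (rule sum.reindex_bij_witness[of _ "\<lambda>(j, i). (j + i, j)" "\<lambda>(k, j). (j, k - j)"])
       (auto simp: drop_take add.commute)
  also have "\<dots> = tmul u (tmul v w) x"
    unfolding tmul_def by (simp add: sum.Sigma[symmetric] sum_distrib_left mult.assoc)
  finally show "tmul (tmul u v) w x = tmul u (tmul v w) x" .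
qed

lemma jacobi: "tbr (tbr u v) w = tbr u (tbr v w) - tbr v (tbr u w)"
  by (simp add: tbr_def tmul_linear tmul_assoc algebra_simps)

subsection \<open>Induced algebra maps\<close>

definition words :: "nat \<Rightarrow> nat \<Rightarrow> gen list set" where
  "words g n = {w. length w = n \<and> set w \<subseteq> gens g}"

lemma finite_words [simp]: "finite (words g n)"
  using finite_lists_length_eq[OF finite_gens, of g n] by (simp add: words_def conj_commute)

lemma words_0 [simp]: "words g 0 = {[]}"
  by (auto simp: words_def)

lemma sum_words_append:
  "(\<Sum>w\<in>words g (m + n). f w) = (\<Sum>u\<in>words g m. \<Sum>v\<in>words g n. f (u @ v))"
proof -
  have "(\<Sum>u\<in>words g m. \<Sum>v\<in>words g n. f (u @ v)) = (\<Sum>(u, v)\<in>words g m \<times> words g n. f (u @ v))"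
    by (simp add: sum.cartesian_product)
  also have "\<dots> = (\<Sum>w\<in>words g (m + n). f w)"
    by (rule sum.reindex_bij_witness[of _ "\<lambda>w. (take m w, drop m w)" "\<lambda>(u, v). u @ v"])
       (auto simp: words_def dest: in_set_takeD in_set_dropD)
  finally show ?thesis ..
qed

lemma sum_words_1: "(\<Sum>w\<in>words g (Suc 0). f w) = (\<Sum>x\<in>gens g. f [x])"
  by (rule sum.reindex_bij_witness[of _ "\<lambda>x. [x]" hd]) (auto simp: words_def length_Suc_conv)

lemma sum_words_2: "(\<Sum>w\<in>words g 2. f w) = (\<Sum>x\<in>gens g. \<Sum>y\<in>gens g. f [x, y])"
  using sum_words_append[of f g 1 1] by (simp add: sum_words_1 numeral_2_eq_2)

lemma Mhat_eq: "Mhat g M u v = (\<Sum>w\<in>words g (length v). u w * (\<Prod>i<length v. M (w ! i) (v ! i)))"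
  by (simp add: Mhat_def words_def)

lemma prod_append_split:
  assumes "length u = length x"
  shows "(\<Prod>i<length (x @ y). M ((u @ v) ! i) ((x @ y) ! i)) =
         (\<Prod>i<length x. M (u ! i) (x ! i)) * (\<Prod>i<length y. M (v ! i) (y ! i) :: rat)"
proof -
  let ?f = "\<lambda>i. M ((u @ v) ! i) ((x @ y) ! i)"
  have "(\<Prod>i<length (x @ y). ?f i) = (\<Prod>i<length x. ?f i) * (\<Prod>i=length x..<length x + length y. ?f i)"
    by (simp add: lessThan_atLeast0 prod.atLeastLessThan_concat)
  also have "(\<Prod>i=length x..<length x + length y. ?f i) = (\<Prod>i<length y. M (v ! i) (y ! i))"
    using assms prod.shift_bounds_nat_ivl[of ?f 0 "length x" "length y"]
    by (simp add: lessThan_atLeast0 nth_append add.commute)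
  also have "(\<Prod>i<length x. ?f i) = (\<Prod>i<length x. M (u ! i) (x ! i))"
    using assms by (intro prod.cong) (auto simp: nth_append)
  finally show ?thesis .
qed

text \<open>The weight of a word is a product over its letters, so it factors along every cut. This
  holds for an arbitrary matrix \<open>M\<close>, which lets the singular map
  \<open>collapse\<close> be handled like a symplectic one.\<close>

lemma Mhat_tmul: "Mhat g M (tmul u v) = tmul (Mhat g M u) (Mhat g M v)"
proof
  fix x
  let ?P = "\<lambda>w x. \<Prod>i<length x. M (w ! i) (x ! i)"
  have "Mhat g M (tmul u v) x =
      (\<Sum>k\<le>length x. \<Sum>w\<in>words g (length x). u (take k w) * v (drop k w) * ?P w x)"
    unfolding Mhat_eq tmul_def
    by (subst sum.swap) (auto simp: words_def sum_distrib_right intro!: sum.cong)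
  also have "\<dots> = (\<Sum>k\<le>length x. Mhat g M u (take k x) * Mhat g M v (drop k x))"
  proof (rule sum.cong[OF refl])
    fix k assume "k \<in> {..length x}"
    then have k: "k \<le> length x" by simp
    let ?a = "take k x" and ?b = "drop k x"
    have "(\<Sum>w\<in>words g (length x). u (take k w) * v (drop k w) * ?P w x)
        = (\<Sum>p\<in>words g (length ?a). \<Sum>q\<in>words g (length ?b).
            u (take k (p @ q)) * v (drop k (p @ q)) * ?P (p @ q) (?a @ ?b))"
      using sum_words_append[of "\<lambda>w. u (take k w) * v (drop k w) * ?P w x" g k "length x - k"] k
      by (simp add: min_absorb2)
    also have "\<dots> = (\<Sum>p\<in>words g (length ?a). \<Sum>q\<in>words g (length ?b).
            (u p * ?P p ?a) * (v q * ?P q ?b))"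
    proof (intro sum.cong refl)
      fix p q assume "p \<in> words g (length ?a)" "q \<in> words g (length ?b)"
      then have "length p = length ?a" "length p = k"
        using k by (auto simp: words_def)
      then show "u (take k (p @ q)) * v (drop k (p @ q)) * ?P (p @ q) (?a @ ?b) =
          (u p * ?P p ?a) * (v q * ?P q ?b)"
        by (subst prod_append_split) auto
    qed
    also have "\<dots> = Mhat g M u ?a * Mhat g M v ?b"
      unfolding Mhat_eq by (simp only: sum_product)
    finally show "(\<Sum>w\<in>words g (length x). u (take k w) * v (drop k w) * ?P w x) =
      Mhat g M u ?a * Mhat g M v ?b" .
  qed
  finally show "Mhat g M (tmul u v) x = tmul (Mhat g M u) (Mhat g M v) x"
    by (simp add: tmul_def)
qed

lemma Mhat_linear:
  "Mhat g M (u + v) = Mhat g M u + Mhat g M v" "Mhat g M (u - v) = Mhat g M u - Mhat g M v"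
  "Mhat g M (tsmul c u) = tsmul c (Mhat g M u)" "Mhat g M (- u) = - Mhat g M u"
  by (auto simp: fun_eq_iff fun_applies Mhat_eq tsmul_def algebra_simps sum.distrib sum_subtractf
      sum_distrib_left sum_negf)

lemma Mhat_zero [simp]: "Mhat g M 0 = 0"
  by (auto simp: fun_eq_iff fun_applies Mhat_eq)

lemma Mhat_tbr: "Mhat g M (tbr u v) = tbr (Mhat g M u) (Mhat g M v)"
  by (simp add: tbr_def Mhat_tmul Mhat_linear)

definition hv :: "hvec \<Rightarrow> tens" where
  "hv h = (\<lambda>w. if length w = 1 then h (hd w) else 0)"

lemma Mhat_tgen: "x \<in> gens g \<Longrightarrow> Mhat g M (tgen x) = hv (M x)"
proof
  fix v assume x: "x \<in> gens g"
  show "Mhat g M (tgen x) v = hv (M x) v"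
  proof (cases "length v = 1")
    case True
    then obtain y where "v = [y]" by (auto simp: length_Suc_conv)
    then show ?thesis using x
      by (simp add: Mhat_eq sum_words_1 hv_def tgen_def if_distrib[of "\<lambda>z. z * _"] cong: if_cong)
  next
    case False
    then have "tgen x w = 0" if "w \<in> words g (length v)" for w
      using that by (auto simp: tgen_def words_def)
    then show ?thesis using False by (simp add: Mhat_eq hv_def)
  qed
qed

lemma hv_linear:
  "hv (h + k) = hv h + hv k" "hv (h - k) = hv h - hv k" "hv (- h) = - hv h"
  "hv (\<lambda>x. c * h x) = tsmul c (hv h)"
  by (auto simp: hv_def fun_eq_iff fun_applies tsmul_def)

definition dlt :: "gen \<Rightarrow> hvec" where
  "dlt x = (\<lambda>y. if y = x then 1 else 0)"

lemma hv_dlt [simp]: "hv (dlt x) = tgen x"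
  by (auto simp: hv_def dlt_def tgen_def fun_eq_iff fun_applies length_Suc_conv)

lemma hv_eq_sum:
  assumes "\<And>y. y \<notin> gens g \<Longrightarrow> h y = 0"
  shows "hv h = (\<Sum>y\<in>gens g. tsmul (h y) (tgen y))"
proof
  fix v
  show "hv h v = (\<Sum>y\<in>gens g. tsmul (h y) (tgen y)) v"
  proof (cases "length v = 1")
    case True
    then obtain y where "v = [y]" by (auto simp: length_Suc_conv)
    then show ?thesis using assms[of y]
      by (auto simp: hv_def sum_fun_apply fun_applies tsmul_def tgen_def if_distrib[of "\<lambda>z. _ * z"] cong: if_cong)
  next
    case False
    then have "tgen y v = 0" for y by (auto simp: tgen_def)
    then show ?thesis using False by (simp add: hv_def sum_fun_apply tsmul_def)
  qed
qed

lemma omega_rel_eq: "omega_rel g = (\<Sum>i\<in>{1..g}. tbr (tgen (A i)) (tgen (B i)))"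
  by (auto simp: omega_rel_def fun_eq_iff fun_applies sum_fun_apply)

subsection \<open>Derivations of the tensor algebra\<close>

text \<open>Factorisations of a word replace the cut positions in \<open>tmul\<close>; with them the
  Leibniz rule becomes a bijection between factorisations.\<close>

definition splits2 :: "gen list \<Rightarrow> (gen list \<times> gen list) set" where
  "splits2 w = {(p, q). p @ q = w}"

definition splits3 :: "gen list \<Rightarrow> (gen list \<times> gen list \<times> gen list) set" where
  "splits3 w = {(p, s, q). p @ s @ q = w}"

lemma finite_splits2 [simp]: "finite (splits2 w)"
proof -
  have "splits2 w \<subseteq> (\<lambda>k. (take k w, drop k w)) ` {..length w}"
  proof
    fix z assume "z \<in> splits2 w"
    then have "z = (take (length (fst z)) w, drop (length (fst z)) w)" "length (fst z) \<le> length w"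
      by (auto simp: splits2_def)
    then show "z \<in> (\<lambda>k. (take k w, drop k w)) ` {..length w}"
      by (intro image_eqI[of _ _ "length (fst z)"]) auto
  qed
  then show ?thesis by (rule finite_subset) simp
qed

lemma splits3_eq: "splits3 w = (\<lambda>((p, r), (s, q)). (p, s, q)) ` (SIGMA x:splits2 w. splits2 (snd x))"
  proof (intro equalityI subsetI)
  fix z assume "z \<in> splits3 w"
  then obtain p s q where "z = (p, s, q)" "p @ s @ q = w"
    by (auto simp: splits3_def)
  then show "z \<in> (\<lambda>((p, r), (s, q)). (p, s, q)) ` (SIGMA x:splits2 w. splits2 (snd x))"
    by (intro image_eqI[of _ _ "((p, s @ q), (s, q))"]) (auto simp: splits2_def)
qed (auto simp: splits3_def splits2_def)

lemma finite_splits3 [simp]: "finite (splits3 w)"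
  unfolding splits3_eq by (intro finite_imageI finite_SigmaI) auto

lemma tmul_eq_splits: "tmul u v w = (\<Sum>(p, q)\<in>splits2 w. u p * v q)"
  unfolding tmul_def splits2_def
  by (rule sum.reindex_bij_witness[of _ "\<lambda>(p, q). length p" "\<lambda>k. (take k w, drop k w)"]) auto

lemma dext_eq: "dext g f u w = (\<Sum>(p, s, q)\<in>splits3 w. \<Sum>x\<in>gens g. u (p @ [x] @ q) * f x s)"
  by (simp add: dext_def splits3_def)

text \<open>A cut falls either before or after the marked letter \<open>x\<close>. The two sums
  become the two terms of the Leibniz rule.\<close>

lemma sum_splits2_middle:
  "(\<Sum>(c, d)\<in>splits2 (p @ [x] @ q). F c d) =
   (\<Sum>(p1, p2)\<in>splits2 p. F p1 (p2 @ [x] @ q)) + (\<Sum>(q1, q2)\<in>splits2 q. F (p @ [x] @ q1) q2)"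
  for F :: "_ \<Rightarrow> _ \<Rightarrow> rat"
proof -
  let ?L = "(\<lambda>(p1, p2). (p1, p2 @ [x] @ q)) ` splits2 p"
  let ?R = "(\<lambda>(q1, q2). (p @ [x] @ q1, q2)) ` splits2 q"
  have "splits2 (p @ [x] @ q) = ?L \<union> ?R"
  proof (intro equalityI subsetI)
    fix z assume "z \<in> splits2 (p @ [x] @ q)"
    then obtain c d where z: "z = (c, d)" and cd: "c @ d = p @ [x] @ q"
      by (auto simp: splits2_def)
    then obtain us where "c = p @ us \<and> us @ d = [x] @ q \<or> c @ us = p \<and> d = us @ [x] @ q"
      by (auto simp: append_eq_append_conv2)
    \<comment> \<open>The two alternatives overlap for the cut directly before \<open>x\<close>.
      Requiring \<open>us\<close> to be nonempty in the second one assigns that cut to the left sum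
      only.\<close>
    then consider us where "c @ us = p" "d = us @ [x] @ q"
      | us where "c = p @ us" "us @ d = [x] @ q" "us \<noteq> []"
      by (cases "us = []") auto
    then show "z \<in> ?L \<union> ?R"
    proof cases
      case 1
      then show ?thesis using z by (auto simp: splits2_def image_iff)
    next
      case 2
      then obtain us' where "us = x # us'" "us' @ d = q"
        by (cases us) auto
      then show ?thesis using z 2 by (auto simp: splits2_def image_iff)
    qed
  qed (auto simp: splits2_def)
  moreover have "?L \<inter> ?R = {}"
    by (auto simp: splits2_def)
  ultimately have "(\<Sum>(c, d)\<in>splits2 (p @ [x] @ q). F c d) =
      (\<Sum>(c, d)\<in>?L. F c d) + (\<Sum>(c, d)\<in>?R. F c d)"
    by (simp add: sum.union_disjoint)
  moreover have "inj_on (\<lambda>(p1, p2). (p1, p2 @ [x] @ q)) (splits2 p)"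
    "inj_on (\<lambda>(q1, q2). (p @ [x] @ q1, q2)) (splits2 q)"
    by (auto simp: inj_on_def)
  ultimately show ?thesis
    by (simp add: sum.reindex case_prod_unfold o_def)
qed

text \<open>The replaced letter sits in one of the two factors. In either case the word splits into
  four pieces, grouped once as a replacement followed by a cut and once as a cut followed by a
  replacement; the two reindexings regroup them.\<close>

lemma dext_tmul: "dext g f (tmul u v) = tmul (dext g f u) v + tmul u (dext g f v)"
proof
  fix w
  let ?X = "gens g"
  have "dext g f (tmul u v) w =
    (\<Sum>(p, s, q)\<in>splits3 w. \<Sum>x\<in>?X. (\<Sum>(p1, p2)\<in>splits2 p. u p1 * v (p2 @ [x] @ q)) * f x s) +
    (\<Sum>(p, s, q)\<in>splits3 w. \<Sum>x\<in>?X. (\<Sum>(q1, q2)\<in>splits2 q. u (p @ [x] @ q1) * v q2) * f x s)"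
    unfolding dext_eq tmul_eq_splits sum_splits2_middle
    by (simp add: case_prod_unfold sum.distrib distrib_right)
  also have "(\<Sum>(p, s, q)\<in>splits3 w. \<Sum>x\<in>?X. (\<Sum>(p1, p2)\<in>splits2 p. u p1 * v (p2 @ [x] @ q)) * f x s)
    = (\<Sum>(p, s, q)\<in>splits3 w. \<Sum>(p1, p2)\<in>splits2 p. \<Sum>x\<in>?X. u p1 * v (p2 @ [x] @ q) * f x s)"
    unfolding sum_distrib_right case_prod_unfold by (subst (2) sum.swap) simp
  also have "\<dots> = (\<Sum>((p, s, q), (p1, p2))\<in>(SIGMA t:splits3 w. splits2 (fst t)).
      \<Sum>x\<in>?X. u p1 * v (p2 @ [x] @ q) * f x s)"
    by (subst sum.Sigma[symmetric]) (auto simp: case_prod_unfold)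
  also have "\<dots> = (\<Sum>((c, d), (p, s, q))\<in>(SIGMA t:splits2 w. splits3 (snd t)).
      \<Sum>x\<in>?X. u c * v (p @ [x] @ q) * f x s)"
    by (rule sum.reindex_bij_witness[of _ "\<lambda>((c, d), (p, s, q)). ((c @ p, s, q), (c, p))"
          "\<lambda>((p, s, q), (p1, p2)). ((p1, p2 @ s @ q), (p2, s, q))"])
       (auto simp: splits2_def splits3_def)
  also have "\<dots> = tmul u (dext g f v) w"
    unfolding tmul_eq_splits dext_eq
    by (subst sum.Sigma[symmetric]) (auto simp: case_prod_unfold sum_distrib_left mult.assoc)
  also have "(\<Sum>(p, s, q)\<in>splits3 w. \<Sum>x\<in>?X. (\<Sum>(q1, q2)\<in>splits2 q. u (p @ [x] @ q1) * v q2) * f x s)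
    = (\<Sum>(p, s, q)\<in>splits3 w. \<Sum>(q1, q2)\<in>splits2 q. \<Sum>x\<in>?X. u (p @ [x] @ q1) * v q2 * f x s)"
    unfolding sum_distrib_right case_prod_unfold by (subst (2) sum.swap) simp
  also have "\<dots> = (\<Sum>((p, s, q), (q1, q2))\<in>(SIGMA t:splits3 w. splits2 (snd (snd t))).
      \<Sum>x\<in>?X. u (p @ [x] @ q1) * v q2 * f x s)"
    by (subst sum.Sigma[symmetric]) (auto simp: case_prod_unfold)
  also have "\<dots> = (\<Sum>((c, d), (p, s, q))\<in>(SIGMA t:splits2 w. splits3 (fst t)).
      \<Sum>x\<in>?X. u (p @ [x] @ q) * v d * f x s)"
    by (rule sum.reindex_bij_witness[of _ "\<lambda>((c, d), (p, s, q)). ((p, s, q @ d), (q, d))"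
          "\<lambda>((p, s, q), (q1, q2)). ((p @ s @ q1, q2), (p, s, q1))"])
       (auto simp: splits2_def splits3_def)
  also have "\<dots> = tmul (dext g f u) v w"
    unfolding tmul_eq_splits dext_eq
    by (subst sum.Sigma[symmetric]) (auto simp: case_prod_unfold sum_distrib_left mult_ac)
  finally show "dext g f (tmul u v) w = (tmul (dext g f u) v + tmul u (dext g f v)) w"
    by (simp add: fun_applies)
qed

lemma dext_linear:
  "dext g f (u + v) = dext g f u + dext g f v" "dext g f (u - v) = dext g f u - dext g f v"
  "dext g f (tsmul c u) = tsmul c (dext g f u)" "dext g f (- u) = - dext g f u"
  by (auto simp: fun_eq_iff fun_applies dext_eq tsmul_def case_prod_unfold algebra_simps sum.distrib
      sum_subtractf sum_distrib_left sum_negf)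

lemma dext_linear_der:
  "dext g (f + f') u = dext g f u + dext g f' u" "dext g (f - f') u = dext g f u - dext g f' u"
  by (auto simp: fun_eq_iff fun_applies dext_eq case_prod_unfold algebra_simps sum.distrib sum_subtractf)

lemma dext_zero [simp]: "dext g f 0 = 0"
  by (auto simp: fun_eq_iff fun_applies dext_eq)

lemma dext_tbr: "dext g f (tbr u v) = tbr (dext g f u) v + tbr u (dext g f v)"
  by (simp add: tbr_def dext_tmul dext_linear algebra_simps)

lemma dext_tgen:
  assumes "x \<in> gens g"
  shows "dext g f (tgen x) = f x"
proof
  fix w
  have "dext g f (tgen x) w = (\<Sum>(p, s, q)\<in>{([], w, [])}. \<Sum>y\<in>gens g. tgen x (p @ [y] @ q) * f y s)"
    unfolding dext_eq
  proof (rule sum.mono_neutral_right)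
    show "\<forall>t\<in>splits3 w - {([], w, [])}. (case t of (p, s, q) \<Rightarrow>
        \<Sum>y\<in>gens g. tgen x (p @ [y] @ q) * f y s) = 0"
      by (auto simp: tgen_def splits3_def append_eq_Cons_conv intro!: sum.neutral split: if_splits)
  qed (use finite_splits3[of w] in \<open>auto simp: splits3_def\<close>)
  then show "dext g f (tgen x) w = f x w"
    using assms by (simp add: tgen_def if_distrib[of "\<lambda>z. z * _"] cong: if_cong)
qed

subsection \<open>The free Lie algebra and the ideal\<close>

lemma LieP_zero [simp]: "LieP g n 0" using LieP.zero by simp
lemma LieP_add: "LieP g n u \<Longrightarrow> LieP g n v \<Longrightarrow> LieP g n (u + v)"
  using LieP.add by simp
lemma LieP_uminus: "LieP g n u \<Longrightarrow> LieP g n (- u)"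
  using LieP.smul[of g n u "-1"] by simp
lemma LieP_diff: "LieP g n u \<Longrightarrow> LieP g n v \<Longrightarrow> LieP g n (u - v)"
  using LieP_add[of g n u "- v"] LieP_uminus[of g n v] by simp
lemma LieP_sum: "(\<And>i. i \<in> S \<Longrightarrow> LieP g n (f i)) \<Longrightarrow> LieP g n (\<Sum>i\<in>S. f i)"
  by (induction S rule: infinite_finite_induct) (auto intro: LieP_add)
lemma LieP_tbr: "LieP g m u \<Longrightarrow> LieP g n v \<Longrightarrow> k = m + n \<Longrightarrow> LieP g k (tbr u v)"
  using LieP.br by simp

lemma IdealP_zero [simp]: "IdealP g n 0" using IdealP.zero by simp
lemma IdealP_add: "IdealP g n u \<Longrightarrow> IdealP g n v \<Longrightarrow> IdealP g n (u + v)"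
  using IdealP.add by simp
lemma IdealP_uminus: "IdealP g n u \<Longrightarrow> IdealP g n (- u)"
  using IdealP.smul[of g n u "-1"] by simp
lemma IdealP_diff: "IdealP g n u \<Longrightarrow> IdealP g n v \<Longrightarrow> IdealP g n (u - v)"
  using IdealP_add[of g n u "- v"] IdealP_uminus[of g n v] by simp
lemma IdealP_sum: "(\<And>i. i \<in> S \<Longrightarrow> IdealP g n (f i)) \<Longrightarrow> IdealP g n (\<Sum>i\<in>S. f i)"
  by (induction S rule: infinite_finite_induct) (auto intro: IdealP_add)
lemma IdealP_tbr: "LieP g m u \<Longrightarrow> IdealP g n v \<Longrightarrow> k = m + n \<Longrightarrow> IdealP g k (tbr u v)"
  using IdealP.br by simp
lemma IdealP_tbr': "IdealP g m u \<Longrightarrow> LieP g n v \<Longrightarrow> k = m + n \<Longrightarrow> IdealP g k (tbr u v)"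
  using IdealP_uminus[OF IdealP_tbr[of g n v m u k]] by (simp add: tbr_swap[of u v])

lemma LieP_omega_rel: "LieP g 2 (omega_rel g)"
  unfolding omega_rel_eq
  by (intro LieP_sum LieP_tbr[of g 1 _ 1] LieP.gen) auto

lemma LieP_dext:
  assumes "LieP g m u" and "\<And>x. x \<in> gens g \<Longrightarrow> LieP g (n + 1) (f x)"
  shows "LieP g (m + n) (dext g f u)"
  using assms(1)
proof induction
  case (gen x)
  then show ?case using assms(2) by (simp add: dext_tgen add.commute)
next
  case (br m u k v)
  then show ?case
    unfolding dext_tbr by (intro LieP_add LieP_tbr[of g "m + n" _ k] LieP_tbr[of g m _ "k + n"]) auto
qed (simp_all add: dext_linear LieP_add LieP.smul)

lemma IdealP_dext:
  assumes "IdealP g m u" and "IsDer g n f"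
  shows "IdealP g (m + n) (dext g f u)"
  using assms(1)
proof induction
  case rel
  have "n + 2 = 2 + n" by simp
  then show ?case using assms(2) unfolding IsDer_def by metis
next
  case (br m u k v)
  have "LieP g (m + n) (dext g f u)"
    using LieP_dext[OF br(1)] assms(2) unfolding IsDer_def by blast
  then show ?case
    using br unfolding dext_tbr
    by (intro IdealP_add IdealP_tbr[of g "m + n" _ k] IdealP_tbr[of g m _ "k + n"]) auto
qed (simp_all add: dext_linear IdealP_add IdealP.smul)

text \<open>Values in the ideal on the generators propagate to all of L(H). This makes the action of
  a derivation on p independent of the representatives chosen for its values.\<close>

lemma IdealP_dext_null:
  assumes "LieP g m u" and "\<And>x. x \<in> gens g \<Longrightarrow> IdealP g (n + 1) (f x)"
  shows "IdealP g (m + n) (dext g f u)"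
  using assms(1)
proof induction
  case (gen x)
  then show ?case using assms(2) by (simp add: dext_tgen add.commute)
next
  case (br m u k v)
  then show ?case
    unfolding dext_tbr by (intro IdealP_add IdealP_tbr'[of g "m + n" _ k] IdealP_tbr[of g m _ "k + n"]) auto
qed (simp_all add: dext_linear IdealP_add IdealP.smul)

lemma dext_ad:
  assumes "LieP g m u"
  shows "dext g (\<lambda>x. tbr y (tgen x)) u = tbr y u"
  using assms by induction (auto simp: dext_linear dext_tgen dext_tbr tbr_linear jacobi)

lemma dext_der_br:
  assumes "LieP g m u"
  shows "dext g (der_br g f1 f2) u = dext g f1 (dext g f2 u) - dext g f2 (dext g f1 u)"
  using assms
proof induction
  case (gen x)
  then show ?case by (simp add: dext_tgen der_br_def)
next
  case (br m u n v)
  show ?case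
    unfolding dext_tbr br.IH dext_linear tbr_linear by (simp add: algebra_simps)
qed (simp_all add: dext_linear tsmul_linear)

lemma IsDer_der_br:
  assumes "IsDer g m f1" "IsDer g n f2"
  shows "IsDer g (m + n) (der_br g f1 f2)"
proof -
  have L: "LieP g (m + n + 1) (dext g f1 (f2 x))" "LieP g (m + n + 1) (dext g f2 (f1 x))"
    if "x \<in> gens g" for x
    using that assms LieP_dext[of g "n + 1" "f2 x" m f1] LieP_dext[of g "m + 1" "f1 x" n f2]
    by (auto simp: IsDer_def add_ac)
  have "IdealP g (m + n + 2) (dext g f1 (dext g f2 (omega_rel g)))"
    "IdealP g (m + n + 2) (dext g f2 (dext g f1 (omega_rel g)))"
    using assms IdealP_dext[of g "n + 2" _ m f1] IdealP_dext[of g "m + 2" _ n f2]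
    by (auto simp: IsDer_def add_ac)
  then have "IdealP g (m + n + 2) (dext g (der_br g f1 f2) (omega_rel g))"
    by (simp only: dext_der_br[OF LieP_omega_rel] IdealP_diff)
  moreover have "LieP g (m + n + 1) (der_br g f1 f2 x)" if "x \<in> gens g" for x
    using L[OF that] by (simp only: der_br_def tens_simps LieP_diff)
  ultimately show ?thesis
    by (simp add: IsDer_def)
qed

lemma IsDer_ad:
  assumes "LieP g n y"
  shows "IsDer g n (\<lambda>x. tbr y (tgen x))"
  using assms IdealP_tbr[OF assms IdealP.rel]
  by (auto simp: IsDer_def dext_ad[OF LieP_omega_rel] intro!: LieP_tbr[OF assms] LieP.gen)

section \<open>Coefficients of Lie elements and of the ideal in low degree\<close>

lemma LieP_support:
  assumes "LieP g n u" "u w \<noteq> 0"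
  shows "length w = n \<and> set w \<subseteq> gens g"
  using assms
proof (induction arbitrary: w)
  case (br m u n v)
  from br(5) have "tmul u v w \<noteq> 0 \<or> tmul v u w \<noteq> 0"
    by (auto simp: tbr_def fun_applies)
  then show ?case
  proof
    assume "tmul u v w \<noteq> 0"
    then obtain k where "k \<le> length w" "u (take k w) * v (drop k w) \<noteq> 0"
      unfolding tmul_def by (metis (no_types, lifting) atMost_iff sum.neutral)
    then show ?case
      using br(3)[of "take k w"] br(4)[of "drop k w"] set_append[of "take k w" "drop k w"]
      by auto
  next
    assume "tmul v u w \<noteq> 0"
    then obtain k where "k \<le> length w" "v (take k w) * u (drop k w) \<noteq> 0"
      unfolding tmul_def by (metis (no_types, lifting) atMost_iff sum.neutral)
    then show ?case
      using br(4)[of "take k w"] br(3)[of "drop k w"] set_append[of "take k w" "drop k w"]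
      by auto
  qed
next
  case (add m u v)
  then show ?case by (cases "u w = 0") (auto simp: fun_applies)
qed (auto simp: tgen_def tsmul_def fun_applies split: if_splits)

text \<open>The rule \<open>zero\<close> makes degree 0 inhabited, so inductions on a bracket of
  total degree 2 or 3 must exclude a factor of degree 0.\<close>

lemma LieP_0: "LieP g 0 u \<Longrightarrow> u = 0"
proof -
  have "LieP g n u \<Longrightarrow> n = 0 \<Longrightarrow> u = 0" for n
    by (induction rule: LieP.induct) auto
  then show "LieP g 0 u \<Longrightarrow> u = 0" by blast
qed

lemma tbr_2:
  assumes "LieP g 1 u" "LieP g 1 v"
  shows "tbr u v [p, q] = u [p] * v [q] - v [p] * u [q]"
proof -
  have "u [] = 0" "v [] = 0" "u [p, q] = 0" "v [p, q] = 0"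
    using LieP_support[OF assms(1), of "[]"] LieP_support[OF assms(2), of "[]"]
      LieP_support[OF assms(1), of "[p, q]"] LieP_support[OF assms(2), of "[p, q]"] by auto
  then show ?thesis
    by (simp add: tbr_def tmul_def fun_applies numeral_2_eq_2 atMost_Suc)
qed

text \<open>Degree 2 of the free Lie algebra is the exterior square of H; its elements are handled
  below as antisymmetric coefficient matrices.\<close>

lemma LieP_2_antisym:
  assumes "LieP g 2 u"
  shows "u [q, p] = - u [p, q]"
proof -
  have "LieP g n u \<Longrightarrow> n = 2 \<Longrightarrow> u [q, p] = - u [p, q]" for n
  proof (induction rule: LieP.induct)
    case (br m u n v)
    then consider "m = 1" "n = 1" | "m = 0" | "n = 0" by linarith
    then show ?case
    proof cases
      case 1
      then show ?thesis using br tbr_2[of g u v] by simp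
    qed (use br LieP_0[of g u] LieP_0[of g v] in \<open>auto simp: fun_applies\<close>)
  qed (auto simp: tsmul_def fun_applies)
  then show ?thesis using assms by blast
qed

text \<open>The ideal is generated in degree 2, so a bracket that reaches degree 3 without being
  zero has a factor from H and a multiple of the relation. The three degrees are proved together
  because each bracket refers to lower ones.\<close>

lemma IdealP_low:
  assumes "IdealP g n u"
  shows "(n < 2 \<longrightarrow> u = 0) \<and> (n = 2 \<longrightarrow> (\<exists>c. u = tsmul c (omega_rel g))) \<and>
    (n = 3 \<longrightarrow> (\<exists>h. LieP g 1 h \<and> u = tbr h (omega_rel g)))"
  using assms
proof induction
  case rel
  show ?case by (auto intro: exI[of _ 1])
next
  case (zero m)
  show ?case by (auto intro: exI[of _ 0])
next
  case (add m u v)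
  have "\<exists>c. u + v = tsmul c (omega_rel g)" if "m = 2"
  proof -
    from add that obtain c d where "u = tsmul c (omega_rel g)" "v = tsmul d (omega_rel g)"
      by auto
    then have "u + v = tsmul (c + d) (omega_rel g)" by (simp add: tsmul_linear)
    then show ?thesis ..
  qed
  moreover have "\<exists>h. LieP g 1 h \<and> u + v = tbr h (omega_rel g)" if "m = 3"
  proof -
    from add that obtain h h' where "LieP g 1 h" "u = tbr h (omega_rel g)"
      "LieP g 1 h'" "v = tbr h' (omega_rel g)" by auto
    then show ?thesis by (intro exI[of _ "h + h'"]) (auto simp: tbr_linear LieP_add)
  qed
  ultimately show ?case using add by auto
next
  case (smul m u c)
  have "\<exists>h. LieP g 1 h \<and> tsmul c u = tbr h (omega_rel g)" if "m = 3"
  proof -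
    from smul that obtain h where "LieP g 1 h" "u = tbr h (omega_rel g)" by auto
    then show ?thesis by (intro exI[of _ "tsmul c h"]) (auto simp: tbr_linear LieP.smul)
  qed
  moreover have "\<exists>d. tsmul c u = tsmul d (omega_rel g)" if "m = 2"
  proof -
    from smul that obtain d where "u = tsmul d (omega_rel g)" by auto
    then have "tsmul c u = tsmul (c * d) (omega_rel g)" by (simp add: tsmul_linear)
    then show ?thesis ..
  qed
  ultimately show ?case using smul by auto
next
  case (br m u n v)
  consider "m = 0" | "n < 2" | "m = 1" "n = 2" | "m + n > 3" by linarith
  then show ?case
  proof cases
    case 1
    then have "u = 0" using br LieP_0 by auto
    then show ?thesis by (auto intro: exI[of _ 0])
  next
    case 2
    then have "v = 0" using br by auto
    then show ?thesis by (auto intro: exI[of _ 0])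
  next
    case 3
    then obtain c where "v = tsmul c (omega_rel g)" using br by auto
    then show ?thesis using 3 br
      by (auto intro!: exI[of _ "tsmul c u"] LieP.smul simp: tbr_linear)
  qed auto
qed

subsection \<open>Degree two and three\<close>

lemma tgen_1: "tgen x [y] = (if y = x then 1 else 0)"
  by (simp add: tgen_def)

lemma LieP_tgen: "x \<in> gens g \<Longrightarrow> LieP g 1 (tgen x)"
  by (rule LieP.gen)

lemma omega_rel_2:
  assumes "p \<in> gens g"
  shows "omega_rel g [p, q] = theta p q"
proof -
  have "omega_rel g [p, q] = (\<Sum>i\<in>{1..g}. tgen (A i) [p] * tgen (B i) [q] - tgen (B i) [p] * tgen (A i) [q])"
    unfolding omega_rel_eq sum_fun_apply
    by (intro sum.cong refl tbr_2[of g] LieP_tgen) auto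
  also have "\<dots> = theta p q"
  proof (cases p)
    case (A j)
    then have "(\<Sum>i\<in>{1..g}. tgen (A i) [p] * tgen (B i) [q] - tgen (B i) [p] * tgen (A i) [q]) =
        (\<Sum>i\<in>{1..g}. if i = j then (if q = B j then 1 else 0) else 0)"
      by (intro sum.cong) (auto simp: tgen_1)
    with A assms show ?thesis by (cases q) (auto simp: theta_def)
  next
    case (B j)
    then have "(\<Sum>i\<in>{1..g}. tgen (A i) [p] * tgen (B i) [q] - tgen (B i) [p] * tgen (A i) [q]) =
        (\<Sum>i\<in>{1..g}. if i = j then (if q = A j then -1 else 0) else 0)"
      by (intro sum.cong) (auto simp: tgen_1)
    with B assms show ?thesis by (cases q) (auto simp: theta_def)
  qed
  finally show ?thesis .
qed

lemma LieP_2_eqI: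
  assumes "LieP g 2 u" "LieP g 2 v" "\<And>p q. p \<in> gens g \<Longrightarrow> q \<in> gens g \<Longrightarrow> u [p, q] = v [p, q]"
  shows "u = v"
proof
  fix w
  show "u w = v w"
  proof (cases "length w = 2 \<and> set w \<subseteq> gens g")
    case True
    then obtain p q where "w = [p, q]" by (auto simp: numeral_2_eq_2 length_Suc_conv)
    with True assms(3) show ?thesis by auto
  next
    case False
    then show ?thesis using LieP_support[OF assms(1), of w] LieP_support[OF assms(2), of w] by metis
  qed
qed

lemma tbr_21:
  assumes "LieP g 2 u" "LieP g 1 v"
  shows "tbr u v [p, q, r] = u [p, q] * v [r] - v [p] * u [q, r]"
proof -
  have u: "u w = 0" if "length w \<noteq> 2" for w using LieP_support[OF assms(1), of w] that by auto
  have v: "v w = 0" if "length w \<noteq> 1" for w using LieP_support[OF assms(2), of w] that by auto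
  show ?thesis
    by (simp add: tbr_def tmul_def fun_applies atMost_Suc u v)
qed

text \<open>Injectivity of \<open>ad\<close> on p(2), already tested on the single generator
  \<open>A 1\<close>. The bracket equals [h, omega] in the free Lie algebra, and comparing
  coefficients of words ending in \<open>A 1\<close> determines half of the matrix of
  \<open>z\<close>; antisymmetry gives the rest.\<close>

lemma ad_kernel:
  assumes "LieP g 2 z" "IdealP g 3 (tbr z (tgen (A 1)))" "g \<ge> 1"
  obtains c where "z = tsmul c (omega_rel g)"
proof -
  obtain h where h: "LieP g 1 h" "tbr z (tgen (A 1)) = tbr h (omega_rel g)"
    using IdealP_low[OF assms(2)] by auto
  have a1: "A 1 \<in> gens g" using assms(3) by simp
  define c where "c = - h [A 1]"
  \<comment> \<open>On the word \<open>[p, q, A 1]\<close>, excluding \<open>p = A 1\<close> removes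
    the second term of the bracket with \<open>z\<close>, and excluding \<open>q = B 1\<close> kills
    the coefficient of the relation at \<open>[q, A 1]\<close>. What remains forces the factor
    \<open>- h [A 1]\<close>.\<close>
  have half: "z [p, q] = c * omega_rel g [p, q]"
    if "p \<in> gens g" "q \<in> gens g" "p \<noteq> A 1" "q \<noteq> B 1" for p q
  proof -
    have "tbr z (tgen (A 1)) [p, q, A 1] = z [p, q]"
      using that by (subst tbr_21[OF assms(1) LieP_tgen[OF a1]]) (simp add: tgen_1)
    moreover have "tbr h (omega_rel g) [p, q, A 1] =
        - (omega_rel g [p, q] * h [A 1] - h [p] * omega_rel g [q, A 1])"
      using tbr_21[OF LieP_omega_rel h(1), of p q "A 1"]
      by (subst tbr_swap) (simp add: fun_applies)
    moreover have "omega_rel g [q, A 1] = 0"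
      using that by (simp add: omega_rel_2 theta_def split: gen.split)
    ultimately have "z [p, q] = - (omega_rel g [p, q] * h [A 1])"
      using h(2) by simp
    then show ?thesis by (simp only: c_def mult_minus_left mult.commute)
  qed
  have "z [p, q] = tsmul c (omega_rel g) [p, q]" if pq: "p \<in> gens g" "q \<in> gens g" for p q
  proof -
    note anti = LieP_2_antisym[OF assms(1)] LieP_2_antisym[OF LieP_omega_rel]
    consider "p \<noteq> A 1" "q \<noteq> B 1" | "q \<noteq> A 1" "p \<noteq> B 1" | "p = q"
      by (cases "p = A 1"; cases "q = B 1"; auto)
    then show ?thesis
    proof cases
      case 1
      then show ?thesis using half pq by (simp add: tsmul_def)
    next
      case 2
      then show ?thesis
        using half[of q p] pq anti(1)[of q p] anti(2)[of g q p] by (simp add: tsmul_def)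
    next
      case 3
      have "z [p, p] = 0" "omega_rel g [p, p] = 0"
        using anti(1)[of p p] anti(2)[of g p p] by linarith+
      then show ?thesis using 3 by (simp add: tsmul_def)
    qed
  qed
  then have "z = tsmul c (omega_rel g)"
    by (intro LieP_2_eqI[OF assms(1) LieP.smul[OF LieP_omega_rel]])
  then show thesis by (rule that)
qed

subsection \<open>The symplectic group\<close>

text \<open>One-sided inverses of square matrices are two-sided; the index set is enumerated so that
  the matrix theorem applies. It is needed because the definition of \<open>Sp\<close> directly
  yields only a right inverse.\<close>

lemma left_right_inverse_on:
  fixes m n :: "'a \<Rightarrow> 'a \<Rightarrow> 'b :: field"
  assumes "finite S"
    and mn: "\<And>x z. x \<in> S \<Longrightarrow> z \<in> S \<Longrightarrow> (\<Sum>y\<in>S. m x y * n y z) = (if x = z then 1 else 0)"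
    and "x \<in> S" "z \<in> S"
  shows "(\<Sum>y\<in>S. n x y * m y z) = (if x = z then 1 else 0)"
proof -
  let ?N = "card S"
  obtain h where h: "bij_betw h {0..<?N} S"
    using ex_bij_betw_nat_finite[OF \<open>finite S\<close>] by blast
  have sum_h: "(\<Sum>y\<in>S. F y) = (\<Sum>j = 0..<?N. F (h j))" for F :: "'a \<Rightarrow> 'b"
    using sum.reindex_bij_betw[OF h, of F] by simp
  have hS: "h i \<in> S" if "i < ?N" for i
    using h that by (auto simp: bij_betw_def)
  have hinj: "h i = h j \<longleftrightarrow> i = j" if "i < ?N" "j < ?N" for i j
    using h that by (auto simp: bij_betw_def inj_on_def)
  define P where "P = mat ?N ?N (\<lambda>(i, j). m (h i) (h j))"
  define Q where "Q = mat ?N ?N (\<lambda>(i, j). n (h i) (h j))"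
  have PQ: "P \<in> carrier_mat ?N ?N" "Q \<in> carrier_mat ?N ?N"
    by (auto simp: P_def Q_def)
  have "P * Q = 1\<^sub>m ?N"
  proof (rule eq_matI)
    fix i j assume "i < dim_row (1\<^sub>m ?N :: 'b mat)" "j < dim_col (1\<^sub>m ?N :: 'b mat)"
    then have ij: "i < ?N" "j < ?N" by auto
    have "(P * Q) $$ (i, j) = (\<Sum>y\<in>S. m (h i) y * n y (h j))"
      using ij by (simp add: P_def Q_def scalar_prod_def sum_h)
    then show "(P * Q) $$ (i, j) = 1\<^sub>m ?N $$ (i, j)"
      using ij mn hS hinj by simp
  qed (auto simp: P_def Q_def)
  then have QP: "Q * P = 1\<^sub>m ?N"
    by (rule mat_mult_left_right_inverse[OF PQ])
  have "x \<in> h ` {0..<?N}" "z \<in> h ` {0..<?N}"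
    using h assms(3,4) by (simp_all add: bij_betw_def)
  then obtain i j where ij: "i < ?N" "j < ?N" "x = h i" "z = h j"
    by auto
  have "(\<Sum>y\<in>S. n x y * m y z) = (Q * P) $$ (i, j)"
    using ij by (simp add: P_def Q_def scalar_prod_def sum_h)
  then show ?thesis using ij hinj by (simp add: QP)
qed

fun dual :: "gen \<Rightarrow> gen" where
  "dual (A i) = B i"
| "dual (B i) = A i"

fun sgn_gen :: "gen \<Rightarrow> rat" where
  "sgn_gen (A i) = 1"
| "sgn_gen (B i) = -1"

lemma dual_simps [simp]: "dual (dual x) = x" "sgn_gen (dual x) = - sgn_gen x"
  "sgn_gen x * sgn_gen x = 1" "sgn_gen x * (sgn_gen x * c) = c" "dual x \<in> gens g \<longleftrightarrow> x \<in> gens g" "dual x = dual y \<longleftrightarrow> x = y"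
  by (cases x; cases y; auto)+

lemma theta_eq: "theta x y = (if y = dual x then sgn_gen x else 0)"
  by (cases x; cases y; auto simp: theta_def)

lemma thetaH_eq: "thetaH g h k = (\<Sum>p\<in>gens g. sgn_gen p * h p * k (dual p))"
  by (simp add: thetaH_def sum_gens)

lemma Sp_support: "M \<in> Sp g \<Longrightarrow> x \<in> gens g \<Longrightarrow> y \<notin> gens g \<Longrightarrow> M x y = 0"
  by (simp add: Sp_def)

lemma Sp_thetaH: "M \<in> Sp g \<Longrightarrow> x \<in> gens g \<Longrightarrow> y \<in> gens g \<Longrightarrow> thetaH g (M x) (M y) = theta x y"
  by (simp add: Sp_def)

text \<open>The symplectic inverse \<open>J M^T J^-1\<close>, where J is the Gram matrix of theta in
  the given basis.\<close>

definition Sp_inv :: "(gen \<Rightarrow> hvec) \<Rightarrow> gen \<Rightarrow> hvec" where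
  "Sp_inv M p z = sgn_gen p * sgn_gen z * M (dual z) (dual p)"

lemma Sp_inv:
  assumes "M \<in> Sp g" "p \<in> gens g" "q \<in> gens g"
  shows "(\<Sum>x\<in>gens g. Sp_inv M p x * M x q) = (if p = q then 1 else 0)"
proof (rule left_right_inverse_on[OF finite_gens _ assms(2,3)])
  fix x z assume xz: "x \<in> gens g" "z \<in> gens g"
  have "(\<Sum>p\<in>gens g. M x p * Sp_inv M p z) = sgn_gen z * thetaH g (M x) (M (dual z))"
    by (simp add: thetaH_eq Sp_inv_def sum_distrib_left mult_ac)
  also have "\<dots> = sgn_gen z * theta x (dual z)"
    using Sp_thetaH[OF assms(1)] xz by simp
  also have "\<dots> = (if x = z then 1 else 0)"
    by (simp add: theta_eq)
  finally show "(\<Sum>p\<in>gens g. M x p * Sp_inv M p z) = (if x = z then 1 else 0)" .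
qed

lemma LieP_hv:
  assumes "\<And>y. y \<notin> gens g \<Longrightarrow> h y = 0"
  shows "LieP g 1 (hv h)"
proof -
  have "hv h = (\<Sum>y\<in>gens g. tsmul (h y) (tgen y))"
    by (rule hv_eq_sum) (rule assms)
  moreover have "LieP g 1 (\<Sum>y\<in>gens g. tsmul (h y) (tgen y))"
    by (intro LieP_sum LieP.smul LieP_tgen)
  ultimately show ?thesis by (simp only:)
qed

lemma LieP_Mhat:
  assumes "LieP g n u" "M \<in> Sp g"
  shows "LieP g n (Mhat g M u)"
  using assms(1)
proof induction
  case (gen x)
  then show ?case
    by (simp only: Mhat_tgen) (intro LieP_hv Sp_support[OF assms(2)])
next
  case (br m u n v)
  show ?case unfolding Mhat_tbr by (intro LieP_tbr[OF br.IH]) simp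
qed (simp_all add: Mhat_linear LieP_add LieP.smul)

lemma Mhat_2: "Mhat g M u [p, q] = (\<Sum>x\<in>gens g. \<Sum>y\<in>gens g. u [x, y] * (M x p * M y q))"
proof -
  have "{..<Suc (Suc 0)} = {0, 1}" by auto
  then show ?thesis
    using sum_words_2[of "\<lambda>w. u w * (\<Prod>i<2. M (w ! i) ([p, q] ! i))" g]
    by (simp add: Mhat_eq numeral_2_eq_2)
qed

text \<open>Membership in \<open>Sp\<close> reads M J M^T = J, whereas invariance of the relation
  reads M^T J M = J. Passing from one to the other uses that \<open>Sp_inv\<close> is also a left
  inverse.\<close>

lemma Mhat_omega_rel:
  assumes "M \<in> Sp g"
  shows "Mhat g M (omega_rel g) = omega_rel g"
proof (rule LieP_2_eqI[OF LieP_Mhat[OF LieP_omega_rel assms] LieP_omega_rel])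
  fix p q assume pq: "p \<in> gens g" "q \<in> gens g"
  have "Mhat g M (omega_rel g) [p, q] = (\<Sum>x\<in>gens g. \<Sum>y\<in>gens g. if y = dual x then sgn_gen x * (M x p * M y q) else 0)"
    unfolding Mhat_2 by (intro sum.cong refl) (simp add: omega_rel_2 theta_eq)
  also have "\<dots> = (\<Sum>x\<in>gens g. sgn_gen x * (M x p * M (dual x) q))"
    by (intro sum.cong refl) simp
  also have "\<dots> = (\<Sum>x\<in>gens g. sgn_gen (dual x) * (M (dual x) p * M x q))"
    by (rule sum.reindex_bij_witness[of _ dual dual]) auto
  also have "\<dots> = sgn_gen p * (\<Sum>x\<in>gens g. Sp_inv M (dual p) x * M x q)"
    by (simp add: Sp_inv_def sum_distrib_left mult_ac)
  also have "\<dots> = omega_rel g [p, q]"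
    using pq by (auto simp: Sp_inv[OF assms] omega_rel_2 theta_eq)
  finally show "Mhat g M (omega_rel g) [p, q] = omega_rel g [p, q]" .
qed

lemma IdealP_Mhat:
  assumes "IdealP g n u" "M \<in> Sp g"
  shows "IdealP g n (Mhat g M u)"
  using assms(1)
proof induction
  case rel
  show ?case unfolding Mhat_omega_rel[OF assms(2)] by (rule IdealP.rel)
next
  case (br m u n v)
  show ?case unfolding Mhat_tbr by (intro IdealP_tbr[OF LieP_Mhat[OF br(1) assms(2)] br.IH]) simp
qed (simp_all add: Mhat_linear IdealP_add IdealP.smul)

subsection \<open>The action on derivations\<close>

definition ad :: "tens \<Rightarrow> gen \<Rightarrow> tens" where
  "ad y = (\<lambda>x. tbr y (tgen x))"

lemma ad_linear: "ad (y + z) = ad y + ad z" "ad (y - z) = ad y - ad z"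
  "ad (tsmul c y) = dsmul c (ad y)" "ad (- y) = - ad y"
  by (auto simp: ad_def fun_eq_iff[where ?'b = tens] fun_applies tbr_linear dsmul_def)

lemma dnull_iff: "dnull g n f \<longleftrightarrow> (\<forall>x\<in>gens g. IdealP g (n + 1) (f x))"
  by (simp add: dnull_def deq_def fun_applies)

lemma deq_iff: "deq g n f f' \<longleftrightarrow> dnull g n (f - f')"
  by (simp add: dnull_iff deq_def fun_applies)

lemma dnull_zero [simp]: "dnull g n 0" by (simp add: dnull_iff fun_applies)
lemma dnull_add: "dnull g n f \<Longrightarrow> dnull g n f' \<Longrightarrow> dnull g n (f + f')"
  by (simp add: dnull_iff fun_applies IdealP_add)
lemma dnull_diff: "dnull g n f \<Longrightarrow> dnull g n f' \<Longrightarrow> dnull g n (f - f')"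
  by (simp add: dnull_iff fun_applies IdealP_diff)
lemma dnull_uminus: "dnull g n f \<Longrightarrow> dnull g n (- f)"
  by (simp add: dnull_iff fun_applies IdealP_uminus)
lemma dnull_dsmul: "dnull g n f \<Longrightarrow> dnull g n (dsmul c f)"
  by (simp add: dnull_iff dsmul_def IdealP.smul)

lemma dsmul_linear:
  "dsmul c (u + v) = dsmul c u + dsmul c v" "dsmul c (u - v) = dsmul c u - dsmul c v"
  "dsmul c (- u) = - dsmul c u" "dsmul (c + d) u = dsmul c u + dsmul d u"
  "dsmul (c - d) u = dsmul c u - dsmul d u" "dsmul c (dsmul d u) = dsmul (c * d) u"
  by (auto simp: dsmul_def fun_eq_iff[where ?'b = tens] fun_applies tsmul_linear)

lemma dsmul_simps [simp]: "dsmul c 0 = 0" "dsmul 0 u = 0" "dsmul 1 u = u" "dsmul (-1) u = - u"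
  "dsmul (- c) u = - dsmul c u"
  by (auto simp: dsmul_def fun_eq_iff[where ?'b = tens] fun_applies)

lemma dlin_linear: "dlin g (E + E') h = dlin g E h + dlin g E' h"
  "dlin g (E - E') h = dlin g E h - dlin g E' h" "dlin g (dsmul c E) h = tsmul c (dlin g E h)"
  by (auto simp: dlin_def dsmul_def tsmul_def fun_eq_iff fun_applies algebra_simps sum.distrib
      sum_subtractf sum_distrib_left)

lemma dlin_eq_sum: "dlin g E h = (\<Sum>y\<in>gens g. tsmul (h y) (E y))"
  by (auto simp: dlin_def fun_eq_iff sum_fun_apply tsmul_def)

lemma dlin_ad:
  assumes "\<And>y. y \<notin> gens g \<Longrightarrow> h y = 0"
  shows "dlin g (ad z) h = tbr z (hv h)"
  by (simp add: dlin_eq_sum hv_eq_sum[of g h, OF assms] tbr_sum tbr_linear ad_def)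

lemma sp_image_add:
  assumes "sp_image g n M D E" "sp_image g n M D' E'"
  shows "sp_image g n M (D + D') (E + E')"
  unfolding sp_image_def
proof
  fix x assume "x \<in> gens g"
  then have "IdealP g (n + 1) ((dlin g E (M x) - Mhat g M (D x)) + (dlin g E' (M x) - Mhat g M (D' x)))"
    using assms by (intro IdealP_add) (auto simp: sp_image_def)
  then show "IdealP g (n + 1) (tsub (dlin g (E + E') (M x)) (Mhat g M ((D + D') x)))"
    by (simp add: dlin_linear Mhat_linear fun_applies algebra_simps)
qed

lemma sp_image_dsmul:
  assumes "sp_image g n M D E"
  shows "sp_image g n M (dsmul c D) (dsmul c E)"
  using assms IdealP.smul[of g "n + 1" _ c]
  by (simp add: sp_image_def dlin_linear dsmul_def[of c D] Mhat_linear tsmul_linear(2)[symmetric])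

lemma sp_image_diff:
  assumes "sp_image g n M D E" "sp_image g n M D' E'"
  shows "sp_image g n M (D - D') (E - E')"
  using sp_image_add[OF assms(1) sp_image_dsmul[OF assms(2), of "-1"]] by simp

text \<open>The values of \<open>E\<close> on the basis are recovered from those on the vectors
  \<open>M x\<close> through \<open>Sp_inv\<close>. Hence the image under \<open>M\<close> is unique
  modulo the ideal, and any congruence between derivations may be transported by
  \<open>M\<close>.\<close>

lemma sp_image_null:
  assumes "sp_image g n M D E" "dnull g n D" "M \<in> Sp g"
  shows "dnull g n E"
  unfolding dnull_iff
proof
  fix y assume y: "y \<in> gens g"
  have I: "IdealP g (n + 1) (dlin g E (M x))" if "x \<in> gens g" for x
  proof -
    have "IdealP g (n + 1) (dlin g E (M x) - Mhat g M (D x))" "IdealP g (n + 1) (Mhat g M (D x))"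
      using assms that by (auto simp: sp_image_def dnull_iff intro: IdealP_Mhat)
    from IdealP_add[OF this] show ?thesis by simp
  qed
  have "E y = (\<Sum>x\<in>gens g. tsmul (Sp_inv M y x) (dlin g E (M x)))"
  proof
    fix w
    have "(\<Sum>x\<in>gens g. tsmul (Sp_inv M y x) (dlin g E (M x))) w =
        (\<Sum>x\<in>gens g. \<Sum>z\<in>gens g. Sp_inv M y x * M x z * E z w)"
      by (simp add: sum_fun_apply tsmul_def dlin_def sum_distrib_left mult.assoc)
    also have "\<dots> = (\<Sum>z\<in>gens g. (\<Sum>x\<in>gens g. Sp_inv M y x * M x z) * E z w)"
      by (subst sum.swap) (simp add: sum_distrib_right)
    also have "\<dots> = (\<Sum>z\<in>gens g. if y = z then E z w else 0)"
      by (intro sum.cong refl) (simp add: Sp_inv[OF assms(3) y])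
    also have "\<dots> = E y w" using y by simp
    finally show "E y w = (\<Sum>x\<in>gens g. tsmul (Sp_inv M y x) (dlin g E (M x))) w" ..
  qed
  then show "IdealP g (n + 1) (E y)"
    using I by (simp add: IdealP_sum IdealP.smul)
qed

lemma sp_image_ad:
  assumes "M \<in> Sp g"
  shows "sp_image g n M (ad y) (ad (Mhat g M y))"
  unfolding sp_image_def
proof
  fix x assume x: "x \<in> gens g"
  have "dlin g (ad (Mhat g M y)) (M x) = tbr (Mhat g M y) (hv (M x))"
    by (rule dlin_ad) (rule Sp_support[OF assms x])
  then show "IdealP g (n + 1) (tsub (dlin g (ad (Mhat g M y)) (M x)) (Mhat g M (ad y x)))"
    by (simp add: ad_def Mhat_tbr Mhat_tgen[OF x])
qed

lemma sp_image_deq: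
  assumes "sp_image g n M D E" "dnull g n (D - D')" "M \<in> Sp g"
  shows "sp_image g n M D' E"
  unfolding sp_image_def
proof
  fix x assume x: "x \<in> gens g"
  have "IdealP g (n + 1) ((dlin g E (M x) - Mhat g M (D x)) + Mhat g M ((D - D') x))"
    using assms x by (intro IdealP_add IdealP_Mhat) (auto simp: sp_image_def dnull_iff)
  then show "IdealP g (n + 1) (tsub (dlin g E (M x)) (Mhat g M (D' x)))"
    by (simp add: Mhat_linear fun_applies)
qed

subsection \<open>A nonvanishing bracket\<close>

text \<open>The images of \<open>w\<^sub>1, w\<^sub>2, w\<^sub>g\<close> are \<open>[a\<^sub>1, b\<^sub>1]\<close>, \<open>-[a\<^sub>1, b\<^sub>1 + b\<^sub>2]\<close>, \<open>[a\<^sub>1, b\<^sub>2]\<close>, which add up to 0.\<close>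
definition collapse :: "nat \<Rightarrow> gen \<Rightarrow> hvec" where
  "collapse g x =
    (if x = A 1 then dlt (A 1) else if x = B 1 then dlt (B 1)
     else if x = A 2 then dlt (B 1) + dlt (B 2) else if x = B 2 then dlt (A 1)
     else if x = A g then dlt (A 1) else if x = B g then dlt (B 2) else 0)"

lemma hv_zero [simp]: "hv 0 = 0"
  by (simp add: hv_def fun_eq_iff fun_applies)

lemma Mhat_collapse_omega_rel:
  assumes "g \<ge> 3"
  shows "Mhat g (collapse g) (omega_rel g) = 0"
proof -
  let ?f = "\<lambda>i. tbr (hv (collapse g (A i))) (hv (collapse g (B i)))"
  have M_sum: "Mhat g M (\<Sum>i\<in>S. u i) = (\<Sum>i\<in>S. Mhat g M (u i))" for M S and u :: "nat \<Rightarrow> tens"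
    using sum_comp_morphism[of "Mhat g M" u S] by (simp add: Mhat_linear o_def)
  have "Mhat g (collapse g) (omega_rel g) = (\<Sum>i\<in>{1..g}. ?f i)"
    unfolding omega_rel_eq M_sum by (intro sum.cong refl) (simp add: Mhat_tbr Mhat_tgen)
  \<comment> \<open>The bound on \<open>g\<close> makes the three indices distinct; every other
    handle is sent to zero.\<close>
  also have "\<dots> = (\<Sum>i\<in>{1, 2, g}. ?f i)"
    using assms by (intro sum.mono_neutral_right) (auto simp: collapse_def)
  also have "\<dots> = 0"
    using assms by (simp add: collapse_def hv_linear tbr_linear tbr_swap[of "tgen (A (Suc 0))"])
  finally show ?thesis .
qed

lemma Mhat_collapse_IdealP:
  assumes "IdealP g n u" "g \<ge> 3"
  shows "Mhat g (collapse g) u = 0"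
  using assms(1)
proof induction
  case rel
  show ?case by (rule Mhat_collapse_omega_rel[OF assms(2)])
qed (simp_all add: Mhat_linear Mhat_tbr)

definition handle :: "nat \<Rightarrow> tens" where
  "handle k = tbr (tgen (A k)) (tgen (B k))"

lemma LieP_handle: "k \<in> {1..g} \<Longrightarrow> LieP g 2 (handle k)"
  unfolding handle_def by (intro LieP_tbr[of g 1 _ 1] LieP_tgen) auto

lemma tmul_tgen_Cons: "tmul (tgen x) v (y # w) = (if y = x then v w else 0)"
proof -
  have "tmul (tgen x) v (y # w) = (\<Sum>k\<in>{1}. tgen x (take k (y # w)) * v (drop k (y # w)))"
    unfolding tmul_def
    by (rule sum.mono_neutral_right) (auto simp: tgen_def take_Cons' split: if_splits)
  then show ?thesis by (simp add: tgen_def)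
qed

lemma bracket_not_IdealP:
  assumes "g \<ge> 3"
  shows "\<not> IdealP g 5 (tbr (tbr (handle 1) (handle g)) (tgen (B 1)))"
proof
  assume "IdealP g 5 (tbr (tbr (handle 1) (handle g)) (tgen (B 1)))"
  from Mhat_collapse_IdealP[OF this assms]
  have "tbr (tbr (tbr (tgen (A 1)) (tgen (B 1))) (tbr (tgen (A 1)) (tgen (B 2)))) (tgen (B 1)) = 0"
    using assms by (simp add: handle_def Mhat_tbr Mhat_tgen collapse_def)
  \<comment> \<open>This word arises only from the product of a_1 b_1, a_1 b_2 and b_1 in the
    expansion, with coefficient 1.\<close>
  then have "tbr (tbr (tbr (tgen (A 1)) (tgen (B 1))) (tbr (tgen (A 1)) (tgen (B 2)))) (tgen (B 1))
      [A 1, B 1, A 1, B 2, B 1] = 0"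
    by (simp only: fun_applies)
  then show False
    by (simp add: tbr_def tmul_linear tmul_assoc fun_applies tmul_tgen_Cons)
       (simp add: tgen_def)
qed

subsection \<open>Submodules\<close>

lemma dext_dsmul: "dext g (dsmul c f) u = tsmul c (dext g f u)"
  by (auto simp: fun_eq_iff dext_eq dsmul_def tsmul_def case_prod_unfold sum_distrib_left mult_ac)

lemma dext_zero_der [simp]: "dext g 0 u = 0"
  using dext_dsmul[of g 0 0 u] by simp

lemma IsDer_zero: "IsDer g n 0"
  by (simp add: IsDer_def fun_applies)

lemma IsDer_add: "IsDer g n f \<Longrightarrow> IsDer g n f' \<Longrightarrow> IsDer g n (f + f')"
  by (simp add: IsDer_def fun_applies LieP_add IdealP_add dext_linear_der)

lemma IsDer_dsmul: "IsDer g n f \<Longrightarrow> IsDer g n (dsmul c f)"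
  by (simp add: IsDer_def dext_dsmul LieP.smul IdealP.smul) (simp add: dsmul_def LieP.smul)

lemma IsDer_ad': "LieP g n y \<Longrightarrow> IsDer g n (ad y)"
  unfolding ad_def by (rule IsDer_ad)

context
  fixes g n U
  assumes U: "submod g n U"
begin

lemma submod_IsDer: "f \<in> U \<Longrightarrow> IsDer g n f"
  using U unfolding submod_def der_simps(1) by blast
lemma submod_deq: "f \<in> U \<Longrightarrow> IsDer g n f' \<Longrightarrow> dnull g n (f - f') \<Longrightarrow> f' \<in> U"
  using U unfolding submod_def deq_iff by blast
lemma submod_zero: "0 \<in> U"
  using U by (simp add: submod_def)
lemma submod_add: "f \<in> U \<Longrightarrow> f' \<in> U \<Longrightarrow> f + f' \<in> U"
  using U unfolding submod_def der_simps(1) by blast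
lemma submod_dsmul: "f \<in> U \<Longrightarrow> dsmul c f \<in> U"
  using U unfolding submod_def der_simps(1) by blast
lemma submod_diff: "f \<in> U \<Longrightarrow> f' \<in> U \<Longrightarrow> f - f' \<in> U"
  using submod_add[of f "dsmul (-1) f'"] submod_dsmul[of f' "-1"] by simp
lemma submod_sp: "M \<in> Sp g \<Longrightarrow> D \<in> U \<Longrightarrow> \<exists>E\<in>U. sp_image g n M D E"
  using U unfolding submod_def by blast

end

text \<open>Closed under congruence modulo the ideal, as \<open>submod\<close> demands, so it can be
  compared with \<open>U2\<close> as a set.\<close>

definition Inn :: "nat \<Rightarrow> (gen \<Rightarrow> tens) set" where
  "Inn g = {f. IsDer g 2 f \<and> (\<exists>y. LieP g 2 y \<and> dnull g 2 (f - ad y))}"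

lemma submod_Inn: "submod g 2 (Inn g)"
  unfolding submod_def
proof (intro conjI ballI allI impI)
  fix f assume "f \<in> Inn g" then show "IsDer g 2 f" by (simp add: Inn_def)
next
  fix f f' assume f: "f \<in> Inn g" "IsDer g 2 f' \<and> deq g 2 f f'"
  then obtain y where y: "LieP g 2 y" "dnull g 2 (f - ad y)" by (auto simp: Inn_def)
  have "dnull g 2 ((f - ad y) - (f - f'))"
    using f(2) dnull_diff[OF y(2)] by (simp only: deq_iff)
  then have "dnull g 2 (f' - ad y)" by simp
  then show "f' \<in> Inn g" using f y by (auto simp: Inn_def)
next
  show "(\<lambda>_. tzero) \<in> Inn g"
    using ad_linear(3)[of 0 0] by (auto simp: Inn_def IsDer_zero intro!: exI[of _ 0])
next
  fix f f' assume "f \<in> Inn g" "f' \<in> Inn g"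
  then obtain y y' where y: "LieP g 2 y" "dnull g 2 (f - ad y)" "LieP g 2 y'" "dnull g 2 (f' - ad y')"
    and "IsDer g 2 f" "IsDer g 2 f'" by (auto simp: Inn_def)
  moreover from dnull_add[OF y(2,4)] have "dnull g 2 (f + f' - ad (y + y'))"
    by (simp add: ad_linear algebra_simps)
  ultimately show "dadd f f' \<in> Inn g"
    by (auto simp: Inn_def IsDer_add intro!: exI[of _ "y + y'"] LieP_add)
next
  fix c f assume "f \<in> Inn g"
  then obtain y where y: "LieP g 2 y" "dnull g 2 (f - ad y)" and "IsDer g 2 f"
    by (auto simp: Inn_def)
  moreover from dnull_dsmul[OF y(2)] have "dnull g 2 (dsmul c f - ad (tsmul c y))"
    by (simp add: ad_linear dsmul_linear)
  ultimately show "dsmul c f \<in> Inn g"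
    by (auto simp: Inn_def IsDer_dsmul intro!: exI[of _ "tsmul c y"] LieP.smul)
next
  fix M D assume M: "M \<in> Sp g" and "D \<in> Inn g"
  then obtain y where y: "LieP g 2 y" "dnull g 2 (D - ad y)" by (auto simp: Inn_def)
  have L: "LieP g 2 (Mhat g M y)" by (rule LieP_Mhat[OF y(1) M])
  have "dnull g 2 (ad y - D)" using dnull_uminus[OF y(2)] by simp
  then have "sp_image g 2 M D (ad (Mhat g M y))"
    by (intro sp_image_deq[OF sp_image_ad[OF M] _ M])
  moreover have "ad (Mhat g M y) \<in> Inn g"
    using L by (auto simp: Inn_def IsDer_ad' intro!: exI[of _ "Mhat g M y"])
  ultimately show "\<exists>E\<in>Inn g. sp_image g 2 M D E" by blast
qed

subsection \<open>Elements of the symplectic group\<close>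

lemma thetaH_linear:
  "thetaH g (\<lambda>y. h y + h' y) k = thetaH g h k + thetaH g h' k"
  "thetaH g (\<lambda>y. h y - h' y) k = thetaH g h k - thetaH g h' k"
  "thetaH g (\<lambda>y. c * h y) k = c * thetaH g h k"
  "thetaH g (\<lambda>y. - h y) k = - thetaH g h k"
  "thetaH g (\<lambda>y. h y / c) k = thetaH g h k / c"
  "thetaH g k (\<lambda>y. h y + h' y) = thetaH g k h + thetaH g k h'"
  "thetaH g k (\<lambda>y. h y - h' y) = thetaH g k h - thetaH g k h'"
  "thetaH g k (\<lambda>y. c * h y) = c * thetaH g k h"
  "thetaH g k (\<lambda>y. - h y) = - thetaH g k h"
  "thetaH g k (\<lambda>y. h y / c) = thetaH g k h / c"
proof -
  show "thetaH g (\<lambda>y. h y + h' y) k = thetaH g h k + thetaH g h' k"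
    "thetaH g k (\<lambda>y. h y + h' y) = thetaH g k h + thetaH g k h'"
    by (simp_all add: thetaH_eq distrib_left distrib_right sum.distrib)
  show "thetaH g (\<lambda>y. h y - h' y) k = thetaH g h k - thetaH g h' k"
    "thetaH g k (\<lambda>y. h y - h' y) = thetaH g k h - thetaH g k h'"
    by (simp_all add: thetaH_eq left_diff_distrib right_diff_distrib sum_subtractf)
  show "thetaH g (\<lambda>y. c * h y) k = c * thetaH g h k" "thetaH g k (\<lambda>y. c * h y) = c * thetaH g k h"
    by (simp_all add: thetaH_eq sum_distrib_left mult_ac)
  show "thetaH g (\<lambda>y. - h y) k = - thetaH g h k" "thetaH g k (\<lambda>y. - h y) = - thetaH g k h"
    by (simp_all add: thetaH_eq sum_negf)
  show "thetaH g (\<lambda>y. h y / c) k = thetaH g h k / c" "thetaH g k (\<lambda>y. h y / c) = thetaH g k h / c"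
    by (simp_all add: thetaH_eq sum_divide_distrib)
qed

lemma thetaH_dlt: "x \<in> gens g \<Longrightarrow> thetaH g (dlt x) h = sgn_gen x * h (dual x)"
proof -
  assume x: "x \<in> gens g"
  have "thetaH g (dlt x) h = (\<Sum>p\<in>gens g. if p = x then sgn_gen x * h (dual x) else 0)"
    unfolding thetaH_eq dlt_def by (intro sum.cong) auto
  then show ?thesis using x by simp
qed

lemma thetaH_dlt_dlt: "x \<in> gens g \<Longrightarrow> thetaH g (dlt x) (dlt y) = theta x y"
  by (simp add: thetaH_dlt theta_eq) (auto simp: dlt_def)

lemma thetaH_expand: "(\<Sum>y\<in>gens g. h y * thetaH g u (dlt y)) = thetaH g u h"
proof -
  have "(\<Sum>y\<in>gens g. h y * thetaH g u (dlt y)) =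
      (\<Sum>y\<in>gens g. \<Sum>p\<in>gens g. if y = dual p then sgn_gen p * u p * h y else 0)"
    unfolding thetaH_eq sum_distrib_left by (intro sum.cong) (auto simp: dlt_def)
  also have "\<dots> = thetaH g u h"
    unfolding thetaH_eq by (subst sum.swap) (auto intro!: sum.cong)
  finally show ?thesis .
qed

lemma dlt_support: "x \<in> gens g \<Longrightarrow> y \<notin> gens g \<Longrightarrow> dlt x y = 0"
  by (auto simp: dlt_def)

lemma sum_dlt: "p \<in> gens g \<Longrightarrow> (\<Sum>x\<in>gens g. f x * dlt x p) = f p"
proof -
  assume "p \<in> gens g"
  moreover have "(\<Sum>x\<in>gens g. f x * dlt x p) = (\<Sum>x\<in>gens g. if x = p then f p else 0)"
    by (intro sum.cong) (auto simp: dlt_def)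
  ultimately show ?thesis by simp
qed

section \<open>Torus elements, exchanges of handles, and maps mixing two handles\<close>

fun torus_val :: "(nat \<Rightarrow> rat) \<Rightarrow> gen \<Rightarrow> rat" where
  "torus_val t (A i) = t i"
| "torus_val t (B i) = inverse (t i)"

lemma torus_eq: "torus t x = (\<lambda>y. torus_val t x * dlt x y)"
  by (cases x) (auto simp: torus_def dlt_def)

lemma torus_Sp:
  assumes "\<And>i. t i \<noteq> 0"
  shows "torus t \<in> Sp g"
  unfolding Sp_def
proof (intro CollectI conjI ballI allI impI)
  fix x y assume "x \<in> gens g" "y \<notin> gens g"
  then show "torus t x y = 0" by (simp add: torus_eq dlt_support[of x g])
next
  fix x y assume "x \<in> gens g" "y \<in> gens g"
  then show "thetaH g (torus t x) (torus t y) = theta x y"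
    unfolding torus_eq thetaH_linear
    by (cases x; cases y) (auto simp: thetaH_dlt_dlt theta_def assms)
qed

lemma Mhat_torus_2:
  assumes "p \<in> gens g" "q \<in> gens g"
  shows "Mhat g (torus t) u [p, q] = torus_val t p * torus_val t q * u [p, q]"
proof -
  have "Mhat g (torus t) u [p, q] =
      (\<Sum>x\<in>gens g. (\<Sum>y\<in>gens g. (u [x, y] * (torus_val t x * torus_val t y)) * dlt y q) * dlt x p)"
    unfolding Mhat_2 torus_eq by (simp add: sum_distrib_left mult_ac)
  then show ?thesis using assms by (simp add: sum_dlt)
qed

fun swap_gen :: "nat \<Rightarrow> nat \<Rightarrow> gen \<Rightarrow> gen" where
  "swap_gen i j (A l) = A (if l = i then j else if l = j then i else l)"
| "swap_gen i j (B l) = B (if l = i then j else if l = j then i else l)"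

lemma swap_gen_gens: "i \<in> {1..g} \<Longrightarrow> j \<in> {1..g} \<Longrightarrow> swap_gen i j x \<in> gens g \<longleftrightarrow> x \<in> gens g"
  by (cases x) auto

lemma swap_gen_swap: "swap_gen i j (swap_gen i j x) = x"
  by (cases x) auto

lemma theta_swap_gen: "theta (swap_gen i j x) (swap_gen i j y) = theta x y"
  by (cases x; cases y) (auto simp: theta_def)

lemma swap_Sp:
  assumes "i \<in> {1..g}" "j \<in> {1..g}"
  shows "(\<lambda>x. dlt (swap_gen i j x)) \<in> Sp g"
  unfolding Sp_def
proof (intro CollectI conjI ballI allI impI)
  fix x y assume "x \<in> gens g" "y \<notin> gens g"
  then show "dlt (swap_gen i j x) y = 0"
    using swap_gen_gens[OF assms] by (intro dlt_support[of _ g]) auto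
next
  fix x y assume "x \<in> gens g" "y \<in> gens g"
  then show "thetaH g (dlt (swap_gen i j x)) (dlt (swap_gen i j y)) = theta x y"
    by (subst thetaH_dlt_dlt) (auto simp: swap_gen_gens[OF assms] theta_swap_gen)
qed

lemma Mhat_swap_2:
  assumes "i \<in> {1..g}" "j \<in> {1..g}" "p \<in> gens g" "q \<in> gens g"
  shows "Mhat g (\<lambda>x. dlt (swap_gen i j x)) u [p, q] = u [swap_gen i j p, swap_gen i j q]"
proof -
  let ?s = "swap_gen i j"
  have eq: "dlt (?s x) p = dlt x (?s p)" for p x
  proof -
    have "p = ?s x \<longleftrightarrow> ?s p = x" by (auto simp: swap_gen_swap)
    then show ?thesis by (auto simp: dlt_def)
  qed
  have "Mhat g (\<lambda>x. dlt (?s x)) u [p, q] =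
      (\<Sum>x\<in>gens g. (\<Sum>y\<in>gens g. u [x, y] * dlt y (?s q)) * dlt x (?s p))"
    unfolding Mhat_2 eq by (simp add: sum_distrib_left mult_ac)
  then show ?thesis using assms swap_gen_gens[OF assms(1,2)] by (simp add: sum_dlt)
qed

text \<open>Here p, q is a hyperbolic pair spanning handle \<open>i\<close>. The goal is to send a_k
  and b_k to multiples of a_k + s p and b_k + t q. These pair to 1 + s t, which explains the
  denominator; the images of a_i and b_i complete them to a symplectic basis of the two
  handles.\<close>

definition mix :: "nat \<Rightarrow> nat \<Rightarrow> hvec \<Rightarrow> hvec \<Rightarrow> rat \<Rightarrow> rat \<Rightarrow> gen \<Rightarrow> hvec" where
  "mix k i p q s t x =
    (if x = A k then (\<lambda>y. (dlt (A k) y + s * p y) / (1 + s * t))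
     else if x = B k then (\<lambda>y. dlt (B k) y + t * q y)
     else if x = A i then (\<lambda>y. (p y - t * dlt (A k) y) / (1 + s * t))
     else if x = B i then (\<lambda>y. q y - s * dlt (B k) y)
     else dlt x)"

lemma mix_Sp:
  assumes ki: "k \<in> {1..g}" "i \<in> {1..g}" "i \<noteq> k" and st: "1 + s * t \<noteq> 0"
    and pq: "p = dlt (A i) \<and> q = dlt (B i) \<or> p = dlt (B i) \<and> q = (\<lambda>y. - dlt (A i) y)"
  shows "mix k i p q s t \<in> Sp g"
  unfolding Sp_def
proof (intro CollectI conjI ballI allI impI)
  fix x y assume x: "x \<in> gens g" "y \<notin> gens g"
  have "dlt (A k) y = 0" "dlt (B k) y = 0" "dlt (A i) y = 0" "dlt (B i) y = 0" "dlt x y = 0"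
    using x ki by (auto intro!: dlt_support)
  then show "mix k i p q s t x y = 0"
    using pq by (auto simp: mix_def)
next
  have d: "thetaH g (dlt x) (dlt y) = theta x y" if "x \<in> gens g" for x y
    using that by (rule thetaH_dlt_dlt)
  fix x y assume xy: "x \<in> gens g" "y \<in> gens g"
  have dA: "A l = dual x \<longleftrightarrow> x = B l" "B l = dual x \<longleftrightarrow> x = A l" for l x
    by (cases x; auto)+
  have pq_self: "thetaH g p p = 0" "thetaH g p q = 1" "thetaH g q p = -1" "thetaH g q q = 0"
    using pq ki by (auto simp: thetaH_linear d theta_eq)
  have pq_other: "thetaH g p (dlt y) = 0" "thetaH g (dlt y) p = 0" "thetaH g q (dlt y) = 0" "thetaH g (dlt y) q = 0"
    if "y \<in> gens g" "y \<noteq> A i" "y \<noteq> B i" for y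
    using pq ki that by (auto simp: thetaH_linear d theta_eq dA)
  have special: "z = A k \<or> z = B k \<or> z = A i \<or> z = B i \<or>
      z \<noteq> A k \<and> z \<noteq> B k \<and> z \<noteq> A i \<and> z \<noteq> B i" for z :: gen
    by blast
  have e: "- (1 / (1 + s * t)) - s * t / (1 + s * t) = - 1"
    using st by (simp add: field_simps)
  show "thetaH g (mix k i p q s t x) (mix k i p q s t y) = theta x y"
    using special[of x] special[of y]
  proof (elim disjE conjE, goal_cases)
  qed (use ki xy st in \<open>simp_all add: mix_def thetaH_linear d pq_self pq_other theta_eq dA e mult.commute[of t s]\<close>)
qed


subsection \<open>The derivations attached to decomposable squares\<close>

text \<open>The value of phi on the square of u wedge v for arbitrary vectors, needed because
  symplectic maps leave the basis. The factor 2 comes from the two equal halves of phi.\<close>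

definition square_der :: "nat \<Rightarrow> hvec \<Rightarrow> hvec \<Rightarrow> gen \<Rightarrow> tens" where
  "square_der g u v x =
    tsmul (2 * thetaH g u (dlt x)) (tbr (hv v) (tbr (hv u) (hv v))) -
    tsmul (2 * thetaH g v (dlt x)) (tbr (hv u) (tbr (hv u) (hv v)))"

lemma phi_eq: "phi u1 v1 u2 v2 x =
    tsmul (theta u1 x) (tbr (tgen v1) (tbr (tgen u2) (tgen v2)))
  - tsmul (theta v1 x) (tbr (tgen u1) (tbr (tgen u2) (tgen v2)))
  + tsmul (theta u2 x) (tbr (tgen v2) (tbr (tgen u1) (tgen v1)))
  - tsmul (theta v2 x) (tbr (tgen u2) (tbr (tgen u1) (tgen v1)))"
  by (simp add: phi_def fun_eq_iff fun_applies tsmul_def)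

lemma phi_square:
  assumes "k \<in> {1..g}"
  shows "phi (A k) (B k) (A k) (B k) = square_der g (dlt (A k)) (dlt (B k))"
proof
  fix x
  have "thetaH g (dlt (A k)) (dlt x) = theta (A k) x" "thetaH g (dlt (B k)) (dlt x) = theta (B k) x"
    using assms by (intro thetaH_dlt_dlt; simp)+
  then show "phi (A k) (B k) (A k) (B k) x = square_der g (dlt (A k)) (dlt (B k)) x"
    by (simp add: phi_eq square_der_def fun_eq_iff fun_applies tsmul_def)
qed

lemma square_der_scale: "square_der g (\<lambda>y. c * u y) v = dsmul (c\<^sup>2) (square_der g u v)"
proof
  fix x
  show "square_der g (\<lambda>y. c * u y) v x = dsmul (c\<^sup>2) (square_der g u v) x"
    by (simp add: square_der_def dsmul_def hv_linear tbr_linear thetaH_linear tsmul_linear power2_eq_square mult_ac)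
qed

lemma sp_image_square_der:
  assumes M: "M \<in> Sp g" and ab: "a \<in> gens g" "b \<in> gens g"
  shows "sp_image g n M (square_der g (dlt a) (dlt b)) (square_der g (M a) (M b))"
  unfolding sp_image_def
proof
  fix x assume x: "x \<in> gens g"
  let ?X = "tbr (hv (M b)) (tbr (hv (M a)) (hv (M b)))" and ?Y = "tbr (hv (M a)) (tbr (hv (M a)) (hv (M b)))"
  have th: "thetaH g (M c) (M x) = thetaH g (dlt c) (dlt x)" if "c \<in> gens g" for c
    using Sp_thetaH[OF M that x] thetaH_dlt_dlt[OF that, of x] by simp
  have "dlin g (square_der g (M a) (M b)) (M x) =
      tsmul (2 * thetaH g (M a) (M x)) ?X - tsmul (2 * thetaH g (M b) (M x)) ?Y"
  proof
    fix w
    have "dlin g (square_der g (M a) (M b)) (M x) w =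
      2 * (\<Sum>y\<in>gens g. M x y * thetaH g (M a) (dlt y)) * ?X w -
      2 * (\<Sum>y\<in>gens g. M x y * thetaH g (M b) (dlt y)) * ?Y w"
      by (simp add: dlin_def square_der_def fun_applies tsmul_def right_diff_distrib sum_subtractf
          sum_distrib_left sum_distrib_right mult_ac)
    then show "dlin g (square_der g (M a) (M b)) (M x) w =
      (tsmul (2 * thetaH g (M a) (M x)) ?X - tsmul (2 * thetaH g (M b) (M x)) ?Y) w"
      by (simp add: thetaH_expand fun_applies tsmul_def)
  qed
  also have "\<dots> = Mhat g M (square_der g (dlt a) (dlt b) x)"
    using ab by (simp add: square_der_def Mhat_linear Mhat_tbr Mhat_tgen th)
  finally show "IdealP g (n + 1) (tsub (dlin g (square_der g (M a) (M b)) (M x)) (Mhat g M (square_der g (dlt a) (dlt b) x)))"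
    by simp
qed

text \<open>This is phi of (a wedge b)(p wedge q) + (a wedge q)(p wedge b), half the coefficient of
  s t in phi of the square of (a + s p) wedge (b + t q).\<close>

definition polar :: "nat \<Rightarrow> hvec \<Rightarrow> hvec \<Rightarrow> hvec \<Rightarrow> hvec \<Rightarrow> gen \<Rightarrow> tens" where
  "polar g a b p q x =
    (let \<alpha> = thetaH g a (dlt x); \<beta> = thetaH g b (dlt x); \<pi> = thetaH g p (dlt x); \<kappa> = thetaH g q (dlt x);
         a = hv a; b = hv b; p = hv p; q = hv q
     in tsmul \<alpha> (tbr b (tbr p q) + tbr q (tbr p b)) + tsmul \<pi> (tbr b (tbr a q) + tbr q (tbr a b))
      - tsmul \<beta> (tbr p (tbr a q) + tbr a (tbr p q)) - tsmul \<kappa> (tbr p (tbr a b) + tbr a (tbr p b)))"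

text \<open>The second difference isolates the coefficient of \<open>s * t\<close>.\<close>
lemma square_der_second_difference:
  fixes g and a b p q :: hvec
  defines "F \<equiv> \<lambda>s t. square_der g (\<lambda>y. a y + s * p y) (\<lambda>y. b y + t * q y)"
  shows "F 2 1 - F 2 (-1) - F (-2) 1 + F (-2) (-1) = dsmul 16 (polar g a b p q)"
proof
  fix x
  have hv_ln: "hv (\<lambda>y. h y + c * k y) = hv h + tsmul c (hv k)" for h k c
    by (simp add: hv_def fun_eq_iff fun_applies tsmul_def)
  show "(F 2 1 - F 2 (-1) - F (-2) 1 + F (-2) (-1)) x = dsmul 16 (polar g a b p q) x"
    unfolding F_def fun_applies square_der_def dsmul_def polar_def Let_def hv_ln tbr_linear thetaH_linear tsmul_linear
    by (rule ext) (simp add: fun_applies tsmul_def algebra_simps)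
qed

definition phiH :: "nat \<Rightarrow> hvec \<Rightarrow> hvec \<Rightarrow> hvec \<Rightarrow> hvec \<Rightarrow> gen \<Rightarrow> tens" where
  "phiH g a b p q x =
    tsmul (thetaH g a (dlt x)) (tbr (hv b) (tbr (hv p) (hv q)))
  - tsmul (thetaH g b (dlt x)) (tbr (hv a) (tbr (hv p) (hv q)))
  + tsmul (thetaH g p (dlt x)) (tbr (hv q) (tbr (hv a) (hv b)))
  - tsmul (thetaH g q (dlt x)) (tbr (hv p) (tbr (hv a) (hv b)))"

text \<open>By the Jacobi identity \<open>phi\<close> kills
  \<open>(a \<and> b)(p \<and> q) - (a \<and> p)(b \<and> q) + (a \<and> q)(b \<and> p)\<close>, the image of the fourth exterior power.\<close>
lemma polar_sum: "polar g a b p q + polar g a b q (\<lambda>y. - p y) = dsmul 3 (phiH g a b p q)"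
proof
  fix x
  have hv_m: "hv (\<lambda>y. - h y) = - hv h" for h
    by (simp add: hv_def fun_eq_iff fun_applies)
  show "(polar g a b p q + polar g a b q (\<lambda>y. - p y)) x = dsmul 3 (phiH g a b p q) x"
    unfolding fun_applies dsmul_def polar_def phiH_def Let_def hv_m tbr_linear thetaH_linear
    unfolding tbr_def tens_simps tmul_linear tmul_assoc tsmul_linear
    by (rule ext) (simp add: fun_applies tsmul_def algebra_simps)
qed

lemma phiH_dlt:
  assumes "k \<in> {1..g}" "i \<in> {1..g}"
  shows "phiH g (dlt (A k)) (dlt (B k)) (dlt (A i)) (dlt (B i)) = phi (A k) (B k) (A i) (B i)"
proof
  fix x
  have "thetaH g (dlt (A k)) (dlt x) = theta (A k) x" "thetaH g (dlt (B k)) (dlt x) = theta (B k) x"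
    "thetaH g (dlt (A i)) (dlt x) = theta (A i) x" "thetaH g (dlt (B i)) (dlt x) = theta (B i) x"
    using assms by (intro thetaH_dlt_dlt; simp)+
  then show "phiH g (dlt (A k)) (dlt (B k)) (dlt (A i)) (dlt (B i)) x = phi (A k) (B k) (A i) (B i) x"
    by (simp add: phi_eq phiH_def)
qed

text \<open>The sum is phi of (a_k wedge b_k) theta. Two of its terms collect the handles into the
  relation and so die in p. In the other two, the expansion of \<open>x\<close> in the symplectic
  basis reassembles [x, w_k].\<close>

lemma sum_phi:
  assumes k: "k \<in> {1..g}" and x: "x \<in> gens g"
  shows "(\<Sum>i\<in>{1..g}. phi (A k) (B k) (A i) (B i) x) =
    tsmul (theta (A k) x) (tbr (tgen (B k)) (omega_rel g)) -
    tsmul (theta (B k) x) (tbr (tgen (A k)) (omega_rel g)) - ad (handle k) x"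
proof -
  have e: "(\<Sum>i\<in>{1..g}. tsmul (theta (A i) x) (tgen (B i)) - tsmul (theta (B i) x) (tgen (A i))) = tgen x"
  proof (cases x)
    case (A j)
    have "(\<Sum>i\<in>{1..g}. tsmul (theta (A i) x) (tgen (B i)) - tsmul (theta (B i) x) (tgen (A i))) =
        (\<Sum>i\<in>{1..g}. if i = j then tgen (A j) else 0)"
      by (intro sum.cong) (auto simp: A theta_def)
    then show ?thesis using x A by simp
  next
    case (B j)
    have "(\<Sum>i\<in>{1..g}. tsmul (theta (A i) x) (tgen (B i)) - tsmul (theta (B i) x) (tgen (A i))) =
        (\<Sum>i\<in>{1..g}. if i = j then tgen (B j) else 0)"
      by (intro sum.cong) (auto simp: B theta_def)
    then show ?thesis using x B by simp
  qed
  have "(\<Sum>i\<in>{1..g}. phi (A k) (B k) (A i) (B i) x) =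
    (\<Sum>i\<in>{1..g}. tsmul (theta (A k) x) (tbr (tgen (B k)) (handle i)) -
      tsmul (theta (B k) x) (tbr (tgen (A k)) (handle i)) +
      tbr (tsmul (theta (A i) x) (tgen (B i)) - tsmul (theta (B i) x) (tgen (A i))) (handle k))"
    by (intro sum.cong refl) (simp add: phi_eq handle_def tbr_linear)
  also have "\<dots> = tsmul (theta (A k) x) (tbr (tgen (B k)) (omega_rel g)) -
      tsmul (theta (B k) x) (tbr (tgen (A k)) (omega_rel g)) + tbr (tgen x) (handle k)"
    unfolding e[symmetric] omega_rel_eq handle_def[symmetric]
    by (simp only: sum.distrib sum_subtractf tbr_sum tsmul_sum tbr_linear)
  finally show ?thesis
    by (simp add: ad_def tbr_swap[of "tgen x"])
qed

subsection \<open>The decomposition of the degree two derivations\<close>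

lemma dnull_ad_omega_rel: "dnull g 2 (ad (omega_rel g))"
  unfolding dnull_iff ad_def
  by (auto intro!: IdealP_tbr'[OF IdealP.rel LieP_tgen])

lemma dnull_ad_iff:
  assumes "LieP g 2 z" "g \<ge> 1"
  shows "dnull g 2 (ad z) \<longleftrightarrow> (\<exists>c. z = tsmul c (omega_rel g))"
proof
  assume "dnull g 2 (ad z)"
  then have "IdealP g 3 (tbr z (tgen (A 1)))"
    using assms(2) by (auto simp: dnull_iff ad_def)
  from ad_kernel[OF assms(1) this assms(2)] show "\<exists>c. z = tsmul c (omega_rel g)" by blast
next
  assume "\<exists>c. z = tsmul c (omega_rel g)"
  then show "dnull g 2 (ad z)"
    by (auto simp: ad_linear dnull_dsmul dnull_ad_omega_rel)
qed

lemma handle_2: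
  assumes "k \<in> {1..g}"
  shows "handle k [p, q] = (if p = A k \<and> q = B k then 1 else if p = B k \<and> q = A k then -1 else 0)"
proof -
  have "handle k [p, q] = tgen (A k) [p] * tgen (B k) [q] - tgen (B k) [p] * tgen (A k) [q]"
    unfolding handle_def using assms by (intro tbr_2[of g] LieP_tgen) auto
  then show ?thesis by (auto simp: tgen_1)
qed

lemma ad_handle_not_null:
  assumes "k \<in> {1..g}" "g \<ge> 2"
  shows "\<not> dnull g 2 (ad (handle k))"
proof
  assume "dnull g 2 (ad (handle k))"
  then obtain c where c: "handle k = tsmul c (omega_rel g)"
    using dnull_ad_iff[OF LieP_handle[OF assms(1)]] assms(2) by auto
  obtain i where i: "i \<in> {1..g}" "i \<noteq> k"
    using assms by (cases "k = 1") (auto intro: that[of 1] that[of 2])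
  have "handle k [A k, B k] = c * omega_rel g [A k, B k]" "handle k [A i, B i] = c * omega_rel g [A i, B i]"
    unfolding c tsmul_def by simp_all
  then show False
    using i assms(1) by (simp add: handle_2[OF assms(1)] omega_rel_2 theta_def)
qed

locale der2_split =
  fixes g :: nat and U1 U2 :: "(gen \<Rightarrow> tens) set"
  assumes g3: "g \<ge> 3"
    and hw1: "highest_weight g 2 U1 lam22"
    and irr2: "irred g 2 U2"
    and split: "\<And>f. IsDer g 2 f \<Longrightarrow> \<exists>u1\<in>U1. \<exists>u2\<in>U2. deq g 2 f (dadd u1 u2)"
    and disj: "\<And>f. f \<in> U1 \<Longrightarrow> f \<in> U2 \<Longrightarrow> dnull g 2 f"
begin

lemma irr1: "irred g 2 U1"
  using hw1 by (simp add: highest_weight_def)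

lemma U1: "submod g 2 U1" and U2: "submod g 2 U2"
  using irr1 irr2 by (simp_all add: irred_def)

text \<open>The projection to \<open>U1\<close>, along \<open>U2\<close>, of the inner derivations.
  Being a submodule of an irreducible module, it is null or all of \<open>U1\<close>.\<close>

definition inner_part where
  "inner_part = {f \<in> U1. \<exists>h\<in>U2. \<exists>y. LieP g 2 y \<and> dnull g 2 (f + h - ad y)}"

lemma submod_inner_part: "submod g 2 inner_part"
  unfolding submod_def
proof (intro conjI ballI allI impI)
  fix f assume "f \<in> inner_part" then show "IsDer g 2 f"
    using submod_IsDer[OF U1] by (simp add: inner_part_def)
next
  fix f f' assume f: "f \<in> inner_part" "IsDer g 2 f' \<and> deq g 2 f f'"
  then obtain h y where y: "h \<in> U2" "LieP g 2 y" "dnull g 2 (f + h - ad y)" and "f \<in> U1"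
    by (auto simp: inner_part_def)
  have n: "dnull g 2 (f - f')" using f(2) by (simp add: deq_iff)
  have "f' \<in> U1" using submod_deq[OF U1 \<open>f \<in> U1\<close>] f(2) n by blast
  moreover have "dnull g 2 (f' + h - ad y)"
    using dnull_diff[OF y(3) n] by (simp add: algebra_simps)
  ultimately show "f' \<in> inner_part" using y by (auto simp: inner_part_def)
next
  have "ad 0 = 0" using ad_linear(3)[of 0 0] by simp
  then show "(\<lambda>_. tzero) \<in> inner_part"
    using submod_zero[OF U1] submod_zero[OF U2]
    by (auto simp: inner_part_def intro!: bexI[of _ 0] exI[of _ 0])
next
  fix f f' assume "f \<in> inner_part" "f' \<in> inner_part"
  then obtain h y h' y' where y: "h \<in> U2" "LieP g 2 y" "dnull g 2 (f + h - ad y)" "f \<in> U1"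
      "h' \<in> U2" "LieP g 2 y'" "dnull g 2 (f' + h' - ad y')" "f' \<in> U1"
    by (auto simp: inner_part_def)
  have "dnull g 2 ((f + f') + (h + h') - ad (y + y'))"
    using dnull_add[OF y(3,7)] by (simp add: ad_linear algebra_simps)
  then show "dadd f f' \<in> inner_part"
    using y submod_add[OF U1 y(4,8)] submod_add[OF U2 y(1,5)] LieP_add[OF y(2,6)]
    unfolding inner_part_def der_simps(1) by blast
next
  fix c f assume "f \<in> inner_part"
  then obtain h y where y: "h \<in> U2" "LieP g 2 y" "dnull g 2 (f + h - ad y)" "f \<in> U1"
    by (auto simp: inner_part_def)
  have "dnull g 2 (dsmul c f + dsmul c h - ad (tsmul c y))"
    using dnull_dsmul[OF y(3), of c] by (simp add: ad_linear dsmul_linear)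
  then show "dsmul c f \<in> inner_part"
    using submod_dsmul[OF U1 y(4)] submod_dsmul[OF U2 y(1)] LieP.smul[OF y(2)]
    unfolding inner_part_def by blast
next
  fix M D assume M: "M \<in> Sp g" and "D \<in> inner_part"
  then obtain h y where y: "h \<in> U2" "LieP g 2 y" "dnull g 2 (D + h - ad y)" "D \<in> U1"
    by (auto simp: inner_part_def)
  obtain E h' where E: "E \<in> U1" "sp_image g 2 M D E" and h': "h' \<in> U2" "sp_image g 2 M h h'"
    using submod_sp[OF U1 M y(4)] submod_sp[OF U2 M y(1)] by blast
  have "dnull g 2 (E + h' - ad (Mhat g M y))"
    by (rule sp_image_null[OF sp_image_diff[OF sp_image_add[OF E(2) h'(2)] sp_image_ad[OF M]] y(3) M])
  then have "E \<in> inner_part" using E h' LieP_Mhat[OF y(2) M] unfolding inner_part_def by blast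
  then show "\<exists>E\<in>inner_part. sp_image g 2 M D E" using E by blast
qed

text \<open>If \<open>inner_part = U1\<close>, the highest weight vector of \<open>U1\<close> agrees up to \<open>U2\<close> with an inner derivation.
  The element \<open>(2, 1, ..., 1)\<close> of the torus acts on it by 4, and on \<open>\<Lambda>\<^sup>2 H\<close> with the
  eigenvalues 2, 1, 1/2 only.\<close>
lemma inner_part_null: "f \<in> inner_part \<Longrightarrow> dnull g 2 f"
proof (rule ccontr)
  assume "f \<in> inner_part" "\<not> dnull g 2 f"
  moreover have "inner_part \<subseteq> U1" by (auto simp: inner_part_def)
  ultimately have "inner_part = U1" using irr1 submod_inner_part unfolding irred_def by blast
  obtain D where D: "D \<in> U1" "\<not> dnull g 2 D"
    "\<And>t. (\<forall>i\<in>{1..g}. t i \<noteq> 0) \<Longrightarrow> sp_image g 2 (torus t) D (dsmul (character g lam22 t) D)"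
    using hw1 unfolding highest_weight_def is_weight_def by blast
  from D(1) have "D \<in> inner_part" using \<open>inner_part = U1\<close> by simp
  then obtain h y where h: "h \<in> U2" "LieP g 2 y" "dnull g 2 (D + h - ad y)"
    unfolding inner_part_def by blast
  define t :: "nat \<Rightarrow> rat" where "t = (\<lambda>i. if i = 1 then 2 else 1)"
  let ?M = "torus t"
  have M: "?M \<in> Sp g" by (rule torus_Sp) (simp add: t_def)
  have "character g lam22 t = (\<Prod>i\<in>{1}. power_int (t i) (lam22 i))"
    unfolding character_def
    by (rule prod.mono_neutral_right) (use g3 in \<open>auto simp: t_def\<close>)
  then have "character g lam22 t = 4"
    by (simp add: t_def lam22_def)
  then have sp: "sp_image g 2 ?M D (dsmul 4 D)"
    using D(3)[of t] by (simp add: t_def)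
  \<comment> \<open>\<open>V c y\<close> says that c D and ad y agree modulo \<open>U2\<close>.
    Applying the torus element and subtracting l times the old relation multiplies c by 4 -
    l.\<close>
  define V where "V c y \<longleftrightarrow> LieP g 2 y \<and> (\<exists>h\<in>U2. dnull g 2 (dsmul c D + h - ad y))" for c y
  have step: "V (c * 4 - l * c) (Mhat g ?M y - tsmul l y)" if V: "V c y" for c y l
  proof -
    obtain h where h: "LieP g 2 y" "h \<in> U2" "dnull g 2 (dsmul c D + h - ad y)"
      using V by (auto simp: V_def)
    obtain h' where h': "h' \<in> U2" "sp_image g 2 ?M h h'"
      using submod_sp[OF U2 M h(2)] by blast
    have "dnull g 2 (dsmul c (dsmul 4 D) + h' - ad (Mhat g ?M y))"
      by (rule sp_image_null[OF sp_image_diff[OF sp_image_add[OF sp_image_dsmul[OF sp] h'(2)]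
            sp_image_ad[OF M]] h(3) M])
    from dnull_diff[OF this dnull_dsmul[OF h(3), of l]]
    have "dnull g 2 (dsmul (c * 4 - l * c) D + (h' - dsmul l h) - ad (Mhat g ?M y - tsmul l y))"
      by (simp add: dsmul_linear ad_linear algebra_simps)
    moreover have "h' - dsmul l h \<in> U2"
      by (intro submod_diff[OF U2] submod_dsmul[OF U2] h'(1) h(2))
    ultimately show ?thesis
      using LieP_diff[OF LieP_Mhat[OF h(1) M] LieP.smul[OF h(1)]] unfolding V_def by blast
  qed
  \<comment> \<open>The factors for the eigenvalues 2, 1 and 1/2 annihilate the exterior square,
    while the coefficient of \<open>D\<close> becomes (4 - 2)(4 - 1)(4 - 1/2) = 21. Hence 21 D lies
    in \<open>U2\<close> up to the ideal.\<close>
  define y1 where "y1 = Mhat g ?M y - tsmul 2 y"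
  define y2 where "y2 = Mhat g ?M y1 - tsmul 1 y1"
  define y3 where "y3 = Mhat g ?M y2 - tsmul (1/2) y2"
  have "V 1 y" using h by (auto simp: V_def)
  then have "V 2 y1" using step[of 1 y 2] by (simp add: y1_def)
  then have "V 6 y2" using step[of 2 y1 1] by (simp add: y2_def)
  then have V3: "V 21 y3" using step[of 6 y2 "1/2"] by (simp add: y3_def)
  have "y3 = 0"
  proof (rule LieP_2_eqI)
    show "LieP g 2 y3" using V3 by (simp add: V_def)
    fix p q assume pq: "p \<in> gens g" "q \<in> gens g"
    define e where "e = torus_val t p * torus_val t q"
    have MH: "Mhat g ?M u [p, q] = e * u [p, q]" for u
      using pq by (simp add: Mhat_torus_2 e_def)
    \<comment> \<open>The eigenvalues 4 and 1/4 occur only at \<open>p = q\<close>, where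
      antisymmetry makes the coefficient vanish.\<close>
    have "y [p, p] = 0" using LieP_2_antisym[OF h(2), of p p] by linarith
    have "torus_val t z = 2 \<and> z = A 1 \<or> torus_val t z = 1/2 \<and> z = B 1 \<or> torus_val t z = 1" for z
      by (cases z) (auto simp: t_def)
    from this[of p] this[of q] have "y [p, q] = 0 \<or> e = 2 \<or> e = 1 \<or> e = 1/2"
      using \<open>y [p, p] = 0\<close> unfolding e_def by (elim disjE conjE; simp)
    then show "y3 [p, q] = 0 [p, q]"
      by (auto simp: y3_def y2_def y1_def fun_applies MH tsmul_def)
  qed simp
  then obtain h where h: "h \<in> U2" "dnull g 2 (dsmul 21 D + h)"
    using V3 ad_linear(3)[of 0 0] by (auto simp: V_def)
  let ?h = "dsmul (-1/21) h"
  have "dnull g 2 (?h - D)"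
    using dnull_dsmul[OF h(2)[unfolded add.commute[of "dsmul 21 D"]], of "-1/21"]
    by (simp add: dsmul_linear)
  with submod_deq[OF U2 submod_dsmul[OF U2 h(1)] submod_IsDer[OF U1 D(1)]] have "D \<in> U2" by blast
  then show False using disj D by blast
qed

text \<open>The \<open>U1\<close> component of an inner derivation lies in \<open>inner_part\<close>
  and is therefore null, so \<open>Inn g\<close> is contained in \<open>U2\<close>. It is not null
  because of \<open>ad (handle 1)\<close>, and irreducibility of \<open>U2\<close> forces
  equality.\<close>

lemma U2_eq_Inn: "U2 = Inn g"
proof -
  have "Inn g \<subseteq> U2"
  proof
    fix f assume "f \<in> Inn g"
    then obtain y where f: "IsDer g 2 f" "LieP g 2 y" "dnull g 2 (f - ad y)"
      by (auto simp: Inn_def)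
    obtain u1 u2 where u: "u1 \<in> U1" "u2 \<in> U2" "dnull g 2 (f - (u1 + u2))"
      using split[OF f(1)] by (auto simp: deq_iff)
    have "dnull g 2 (u1 + u2 - ad y)"
      using dnull_diff[OF f(3) u(3)] by simp
    then have "u1 \<in> inner_part" using u f unfolding inner_part_def by blast
    then have "dnull g 2 u1" by (rule inner_part_null)
    from dnull_uminus[OF dnull_add[OF u(3) this]] have "dnull g 2 (u2 - f)"
      by (simp add: algebra_simps)
    then show "f \<in> U2" using submod_deq[OF U2 u(2) f(1)] by blast
  qed
  moreover have "ad (handle 1) \<in> Inn g"
    using LieP_handle[of 1 g] g3 by (auto simp: Inn_def IsDer_ad' intro!: exI[of _ "handle 1"])
  moreover have "\<not> dnull g 2 (ad (handle 1))"
    using g3 by (intro ad_handle_not_null) auto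
  ultimately show ?thesis
    using irr2 submod_Inn unfolding irred_def by blast
qed

section \<open>The components of the derivation attached to one handle\<close>

lemma U1_inner_null:
  assumes "f \<in> U1" "LieP g 2 y" "dnull g 2 (f - ad y)"
  shows "dnull g 2 (ad y)"
proof -
  have "f \<in> U2"
    using assms submod_IsDer[OF U1] by (auto simp: U2_eq_Inn Inn_def)
  then have "dnull g 2 f" using disj assms(1) by blast
  from dnull_diff[OF this assms(3)] show ?thesis by simp
qed

text \<open>A map fixing a_k and b_k fixes the derivation, so subtracting the two decompositions
  shows that ad (y - M y) agrees with an element of \<open>U1\<close>. An inner derivation in
  \<open>U1\<close> is null, which leaves y - M y in the kernel of \<open>ad\<close>.\<close>

lemma component_stable:
  assumes z: "z1 \<in> U1" "dnull g 2 (square_der g (dlt (A k)) (dlt (B k)) - z1 - ad y)" "LieP g 2 y"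
    and M: "M \<in> Sp g" "M (A k) = dlt (A k)" "M (B k) = dlt (B k)" and k: "k \<in> {1..g}"
  shows "\<exists>c. y - Mhat g M y = tsmul c (omega_rel g)"
proof -
  let ?Q = "square_der g (dlt (A k)) (dlt (B k))"
  obtain E where E: "E \<in> U1" "sp_image g 2 M z1 E"
    using submod_sp[OF U1 M(1) z(1)] by blast
  have "sp_image g 2 M ?Q ?Q"
    using sp_image_square_der[OF M(1), of "A k" "B k" 2] k M by simp
  then have "dnull g 2 (?Q - E - ad (Mhat g M y))"
    by (intro sp_image_null[OF sp_image_diff[OF sp_image_diff[OF _ E(2)] sp_image_ad[OF M(1)]] z(2) M(1)])
  from dnull_diff[OF z(2) this] have n: "dnull g 2 ((E - z1) - ad (y - Mhat g M y))"
    by (simp add: ad_linear algebra_simps)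
  have L: "LieP g 2 (y - Mhat g M y)"
    using z(3) M(1) by (intro LieP_diff LieP_Mhat)
  have "dnull g 2 (ad (y - Mhat g M y))"
    by (rule U1_inner_null[OF submod_diff[OF U1 E(1) z(1)] L n])
  then show ?thesis using dnull_ad_iff[OF L] g3 by simp
qed

text \<open>Torus elements remove all coefficients off the pairs a_i, b_i, and exchanging handles
  makes the coefficients on those pairs equal away from \<open>k\<close>. The ambiguity by the
  relation is resolved by reading coefficients where it is known.\<close>

lemma component_shape:
  assumes z: "z1 \<in> U1" "dnull g 2 (square_der g (dlt (A k)) (dlt (B k)) - z1 - ad y)" "LieP g 2 y"
    and k: "k \<in> {1..g}"
  obtains c d where "y = tsmul c (handle k) + tsmul d (omega_rel g)"
proof -
  note stable = component_stable[OF z _ _ _ k]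
  have off: "y [p, q] = 0" if pq: "p \<in> gens g" "q \<in> gens g" "q \<noteq> dual p" for p q
  proof (cases "p = q")
    case True
    then show ?thesis using LieP_2_antisym[OF z(3), of p p] by simp
  next
    case False
    define idx where "idx x = (case x of A i \<Rightarrow> i | B i \<Rightarrow> i)" for x
    have "idx p \<noteq> idx q"
      using pq False by (cases p; cases q) (auto simp: idx_def)
    \<comment> \<open>The letters have different indices, so one index differs from
      \<open>k\<close>. Scaling that handle fixes handle \<open>k\<close> and acts on exactly one of
      the two letters, with eigenvalue 2 or 1/2.\<close>
    define i where "i = (if idx p = k then idx q else idx p)"
    define t where "t = (\<lambda>j. if j = i then 2 else 1 :: rat)"
    have "i \<noteq> k" using \<open>idx p \<noteq> idx q\<close> by (auto simp: i_def)
    have tv: "torus_val t x = (if idx x = i then (case x of A _ \<Rightarrow> 2 | B _ \<Rightarrow> 1/2) else 1)" for x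
      by (cases x) (auto simp: t_def idx_def)
    have "torus t (A k) = dlt (A k)" "torus t (B k) = dlt (B k)"
      using \<open>i \<noteq> k\<close> by (simp_all add: torus_eq t_def)
    then obtain c where c: "y - Mhat g (torus t) y = tsmul c (omega_rel g)"
      using stable[of "torus t"] by (auto simp: torus_Sp t_def)
    have "(y - Mhat g (torus t) y) [p, q] = 0"
      unfolding c using pq by (simp add: tsmul_def omega_rel_2 theta_eq)
    then have "y [p, q] = torus_val t p * torus_val t q * y [p, q]"
      using pq by (simp add: fun_applies Mhat_torus_2)
    moreover have "torus_val t p * torus_val t q \<noteq> 1"
      using \<open>idx p \<noteq> idx q\<close> by (auto simp: tv i_def split: gen.split)
    ultimately show ?thesis by simp
  qed
  have diag: "y [A i, B i] = y [A j, B j]" if ij: "i \<in> {1..g}" "j \<in> {1..g}" "i \<noteq> k" "j \<noteq> k" for i j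
  proof -
    let ?M = "\<lambda>x. dlt (swap_gen i j x)"
    obtain c where c: "y - Mhat g ?M y = tsmul c (omega_rel g)"
      using stable[of ?M] swap_Sp[OF ij(1,2)] ij by auto
    \<comment> \<open>The exchange leaves handle \<open>k\<close> alone, but the relation has
      coefficient 1 there, so the ambiguity constant must vanish.\<close>
    have "(y - Mhat g ?M y) [A k, B k] = 0"
      using k ij by (simp add: fun_applies Mhat_swap_2)
    then have "c = 0"
      unfolding c using k by (simp add: tsmul_def omega_rel_2 theta_def)
    then have "(y - Mhat g ?M y) [A i, B i] = 0"
      unfolding c by (simp add: fun_applies)
    then show ?thesis using ij by (simp add: fun_applies Mhat_swap_2)
  qed
  obtain j where j: "j \<in> {1..g}" "j \<noteq> k"
    using g3 by (cases "k = 1") (auto intro: that[of 1] that[of 2])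
  define d where "d = y [A j, B j]"
  define c where "c = y [A k, B k] - d"
  have val: "y [A i, B i] = (tsmul c (handle k) + tsmul d (omega_rel g)) [A i, B i]" if "i \<in> {1..g}" for i
    using that diag[of i j] j k
    by (cases "i = k") (auto simp: fun_applies tsmul_def handle_2 omega_rel_2 theta_def c_def d_def)
  have L: "LieP g 2 (tsmul c (handle k) + tsmul d (omega_rel g))"
    by (intro LieP_add LieP.smul LieP_handle LieP_omega_rel k)
  have "y = tsmul c (handle k) + tsmul d (omega_rel g)"
  proof (rule LieP_2_eqI[OF z(3) L])
    fix p q assume pq: "p \<in> gens g" "q \<in> gens g"
    show "y [p, q] = (tsmul c (handle k) + tsmul d (omega_rel g)) [p, q]"
    proof (cases "q = dual p")
      case False
      then show ?thesis
        using pq off[OF pq] by (cases p) (auto simp: fun_applies tsmul_def handle_2[OF k] omega_rel_2 theta_eq)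
    next
      case True
      show ?thesis
      proof (cases p)
        case (A i)
        then show ?thesis using True val[of i] pq by simp
      next
        case (B i)
        then show ?thesis
          using True val[of i] pq LieP_2_antisym[OF z(3), of "B i" "A i"] LieP_2_antisym[OF L, of "B i" "A i"]
          by simp
      qed
    qed
  qed
  then show thesis by (rule that)
qed

text \<open>Otherwise all derivations in the span of the orbit would agree with elements of
  \<open>U1\<close>, including the inner derivation - ad w_k produced by \<open>sum_phi\<close>.
  Such a derivation would be null, contradicting \<open>ad_handle_not_null\<close>.\<close>

lemma square_der_not_in_U1:
  assumes z: "z1 \<in> U1" and k: "k \<in> {1..g}"
  shows "\<not> dnull g 2 (square_der g (dlt (A k)) (dlt (B k)) - z1)"
proof
  let ?Q = "square_der g (dlt (A k)) (dlt (B k))"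
  assume n: "dnull g 2 (?Q - z1)"
  \<comment> \<open>Membership in \<open>U1\<close> includes \<open>IsDer\<close>, which is not
    established for the polarized maps; congruence to an element of \<open>U1\<close> is enough and
    is preserved by linear combinations.\<close>
  define V where "V = {F. \<exists>E\<in>U1. dnull g 2 (F - E)}"
  have V_add: "F + F' \<in> V" if F: "F \<in> V" "F' \<in> V" for F F'
  proof -
    obtain E E' where E: "E \<in> U1" "dnull g 2 (F - E)" "E' \<in> U1" "dnull g 2 (F' - E')"
      using F by (auto simp: V_def)
    have "dnull g 2 ((F + F') - (E + E'))"
      using dnull_add[OF E(2,4)] by (simp add: algebra_simps)
    then show ?thesis using submod_add[OF U1 E(1,3)] unfolding V_def by blast
  qed
  have V_dsmul: "dsmul c F \<in> V" if F: "F \<in> V" for c F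
  proof -
    obtain E where E: "E \<in> U1" "dnull g 2 (F - E)"
      using F by (auto simp: V_def)
    have "dnull g 2 (dsmul c F - dsmul c E)"
      using dnull_dsmul[OF E(2)] by (simp add: dsmul_linear)
    then show ?thesis using submod_dsmul[OF U1 E(1)] unfolding V_def by blast
  qed
  have V_diff: "F - F' \<in> V" if F: "F \<in> V" "F' \<in> V" for F F'
    using V_add[OF F(1) V_dsmul[OF F(2), of "-1"]] by simp
  have V_sum: "(\<Sum>i\<in>S. F i) \<in> V" if "finite S" "\<And>i. i \<in> S \<Longrightarrow> F i \<in> V" for S :: "nat set" and F
    using that
  proof (induction S)
    case empty
    show "(\<Sum>i\<in>{}. F i) \<in> V"
      using submod_zero[OF U1] by (auto simp: V_def intro!: bexI[of _ 0])
  next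
    case (insert i S)
    then have "F i + (\<Sum>i\<in>S. F i) \<in> V" by (intro V_add) auto
    then show "(\<Sum>i\<in>insert i S. F i) \<in> V" using insert.hyps by simp
  qed
  have V_orbit: "square_der g (M (A k)) (M (B k)) \<in> V" if M: "M \<in> Sp g" for M
  proof -
    obtain E where E: "E \<in> U1" "sp_image g 2 M z1 E"
      using submod_sp[OF U1 M z(1)] by blast
    have "sp_image g 2 M ?Q (square_der g (M (A k)) (M (B k)))"
      using sp_image_square_der[OF M] k by simp
    from sp_image_null[OF sp_image_diff[OF this E(2)] n M] show ?thesis
      using E(1) unfolding V_def by blast
  qed
  have V_phi: "phi (A k) (B k) (A i) (B i) \<in> V" if i: "i \<in> {1..g}" "i \<noteq> k" for i
  proof -
    have V_polar: "polar g (dlt (A k)) (dlt (B k)) p q \<in> V"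
      if pq: "p = dlt (A i) \<and> q = dlt (B i) \<or> p = dlt (B i) \<and> q = (\<lambda>y. - dlt (A i) y)" for p q
    proof -
      let ?F = "\<lambda>s t. square_der g (\<lambda>y. dlt (A k) y + s * p y) (\<lambda>y. dlt (B k) y + t * q y)"
      have F: "?F s t \<in> V" if st: "1 + s * t \<noteq> 0" for s t
      proof -
        \<comment> \<open>The denominator in \<open>mix\<close> only rescales this quadratic
          expression and is cleared by the square of 1 + s t.\<close>
        have "square_der g (\<lambda>y. (1 / (1 + s * t)) * (dlt (A k) y + s * p y)) (\<lambda>y. dlt (B k) y + t * q y) \<in> V"
          using V_orbit[OF mix_Sp[OF k i st pq]] by (simp add: mix_def)
        then have "dsmul ((1 + s * t)\<^sup>2) (dsmul ((1 / (1 + s * t))\<^sup>2) (?F s t)) \<in> V"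
          unfolding square_der_scale by (rule V_dsmul)
        moreover have "(1 + s * t)\<^sup>2 * (1 / (1 + s * t))\<^sup>2 = 1"
          using st by (simp add: power_divide)
        ultimately show ?thesis by (simp only: dsmul_linear dsmul_simps)
      qed
      \<comment> \<open>With s = 2, -2 and t = 1, -1 the number 1 + s t is 3 or -1; taking s = 1, -1
        would make it vanish.\<close>
      have "?F 2 1 - ?F 2 (-1) - ?F (-2) 1 + ?F (-2) (-1) \<in> V"
        by (intro V_add V_diff F) simp_all
      then have "dsmul (1/16) (dsmul 16 (polar g (dlt (A k)) (dlt (B k)) p q)) \<in> V"
        unfolding square_der_second_difference by (rule V_dsmul)
      then show ?thesis by (simp add: dsmul_linear)
    qed
    have "polar g (dlt (A k)) (dlt (B k)) (dlt (A i)) (dlt (B i)) +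
        polar g (dlt (A k)) (dlt (B k)) (dlt (B i)) (\<lambda>y. - dlt (A i) y) \<in> V"
      by (intro V_add V_polar) auto
    then have "dsmul (1/3) (dsmul 3 (phi (A k) (B k) (A i) (B i))) \<in> V"
      unfolding polar_sum phiH_dlt[OF k i(1)] by (rule V_dsmul)
    then show ?thesis by (simp add: dsmul_linear)
  qed
  have "?Q \<in> V" using n z unfolding V_def by blast
  \<comment> \<open>The summand for i = k is the square itself, which lies in \<open>V\<close> by
    assumption rather than by polarization.\<close>
  then have "(\<Sum>i\<in>{1..g}. phi (A k) (B k) (A i) (B i)) \<in> V"
    using V_phi phi_square[OF k] by (intro V_sum) (simp, metis)
  then obtain E where E: "E \<in> U1" "dnull g 2 ((\<Sum>i\<in>{1..g}. phi (A k) (B k) (A i) (B i)) - E)"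
    by (auto simp: V_def)
  have "dnull g 2 ((\<Sum>i\<in>{1..g}. phi (A k) (B k) (A i) (B i)) + ad (handle k))"
    unfolding dnull_iff
  proof
    fix x assume x: "x \<in> gens g"
    have "IdealP g (2 + 1) (tsmul (theta (A k) x) (tbr (tgen (B k)) (omega_rel g)) -
      tsmul (theta (B k) x) (tbr (tgen (A k)) (omega_rel g)))"
      using k by (intro IdealP_diff IdealP.smul IdealP_tbr[OF LieP_tgen IdealP.rel]) auto
    then show "IdealP g (2 + 1) (((\<Sum>i\<in>{1..g}. phi (A k) (B k) (A i) (B i)) + ad (handle k)) x)"
      by (simp only: fun_applies sum_fun_apply sum_phi[OF k x] diff_add_cancel)
  qed
  from dnull_diff[OF this E(2)] have "dnull g 2 (E - ad (- handle k))"
    by (simp add: ad_linear add.commute)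
  from U1_inner_null[OF E(1) LieP_uminus[OF LieP_handle[OF k]] this]
  have "dnull g 2 (ad (handle k))"
    using dnull_uminus[of g 2 "ad (- handle k)"] by (simp add: ad_linear)
  then show False using ad_handle_not_null[OF k] g3 by simp
qed

lemma component:
  assumes k: "k \<in> {1..g}" and z: "z1 \<in> U1" "z2 \<in> U2"
    and eq: "deq g 2 (phi (A k) (B k) (A k) (B k)) (dadd z1 z2)"
  obtains c where "c \<noteq> 0" "dnull g 2 (z1 - (square_der g (dlt (A k)) (dlt (B k)) - ad (tsmul c (handle k))))"
proof -
  let ?Q = "square_der g (dlt (A k)) (dlt (B k))"
  obtain y where y: "LieP g 2 y" "dnull g 2 (z2 - ad y)"
    using z(2) by (auto simp: U2_eq_Inn Inn_def)
  have "dnull g 2 (?Q - (z1 + z2))"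
    using eq by (simp add: deq_iff phi_square[OF k])
  from dnull_add[OF this y(2)] have n: "dnull g 2 (?Q - z1 - ad y)"
    by (simp add: algebra_simps)
  obtain c d where cd: "y = tsmul c (handle k) + tsmul d (omega_rel g)"
    using component_shape[OF z(1) n y(1) k] by blast
  have "dnull g 2 (ad (tsmul d (omega_rel g)))"
    unfolding ad_linear by (intro dnull_dsmul dnull_ad_omega_rel)
  from dnull_add[OF n this] have n': "dnull g 2 (?Q - z1 - ad (tsmul c (handle k)))"
    by (simp add: cd ad_linear algebra_simps)
  have "c \<noteq> 0"
  proof
    assume "c = 0"
    then have "dnull g 2 (?Q - z1)" using n' ad_linear(3)[of 0 0] by simp
    then show False using square_der_not_in_U1[OF z(1) k] by blast
  qed
  moreover have "dnull g 2 (z1 - (?Q - ad (tsmul c (handle k))))"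
    using dnull_uminus[OF n'] by (simp add: algebra_simps)
  ultimately show thesis by (rule that)
qed

end

subsection \<open>The bracket\<close>

lemma square_der_basis:
  assumes "k \<in> {1..g}"
  shows "square_der g (dlt (A k)) (dlt (B k)) x =
    tsmul (2 * theta (A k) x) (tbr (tgen (B k)) (handle k)) - tsmul (2 * theta (B k) x) (tbr (tgen (A k)) (handle k))"
proof -
  have "thetaH g (dlt (A k)) (dlt x) = theta (A k) x" "thetaH g (dlt (B k)) (dlt x) = theta (B k) x"
    using assms by (intro thetaH_dlt_dlt; simp)+
  then show ?thesis by (simp add: square_der_def handle_def)
qed

text \<open>On the generators of handle \<open>k\<close> the derivation acts as -2 ad w_k, and on
  the others it is zero. So w_k goes to a multiple of [w_k, w_k], and this already holds in the free
  Lie algebra.\<close>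

lemma dext_square_der_handle:
  assumes "k \<in> {1..g}" "j \<in> {1..g}"
  shows "dext g (square_der g (dlt (A k)) (dlt (B k))) (handle j) = 0"
proof -
  let ?Q = "square_der g (dlt (A k)) (dlt (B k))"
  have "dext g ?Q (handle j) = tbr (?Q (A j)) (tgen (B j)) + tbr (tgen (A j)) (?Q (B j))"
    using assms by (simp add: handle_def dext_tbr dext_tgen)
  also have "\<dots> = 0"
  proof (cases "j = k")
    case True
    have "tbr (?Q (A k)) (tgen (B k)) + tbr (tgen (A k)) (?Q (B k)) =
        tsmul 2 (tbr (tgen (A k)) (tbr (tgen (B k)) (handle k)) - tbr (tgen (B k)) (tbr (tgen (A k)) (handle k)))"
      using tbr_swap[of "tbr (tgen (A k)) (handle k)" "tgen (B k)"]
      by (simp add: square_der_basis[OF assms(1)] theta_def tbr_linear tsmul_linear)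
    also have "\<dots> = tsmul 2 (tbr (handle k) (handle k))"
      by (simp only: jacobi[symmetric] handle_def[symmetric])
    finally show ?thesis using True by simp
  next
    case False
    then show ?thesis by (simp add: square_der_basis[OF assms(1)] theta_def)
  qed
  finally show ?thesis .
qed

lemma dext_square_der_square_der:
  assumes "k \<in> {1..g}" "l \<in> {1..g}" "k \<noteq> l" "x \<in> gens g"
  shows "dext g (square_der g (dlt (A k)) (dlt (B k))) (square_der g (dlt (A l)) (dlt (B l)) x) = 0"
proof -
  have "square_der g (dlt (A k)) (dlt (B k)) (A l) = 0" "square_der g (dlt (A k)) (dlt (B k)) (B l) = 0"
    using assms(3) by (simp_all add: square_der_basis[OF assms(1)] theta_def)
  then show ?thesis
    using assms(2) by (simp add: square_der_basis[OF assms(2)] dext_linear dext_tbr dext_tgen dext_square_der_handle[OF assms(1,2)])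
qed

lemma LieP_square_der:
  assumes "k \<in> {1..g}"
  shows "LieP g 3 (square_der g (dlt (A k)) (dlt (B k)) x)"
  unfolding square_der_basis[OF assms] using assms
  by (intro LieP_diff LieP.smul LieP_tbr[OF LieP_tgen LieP_handle]) auto

lemma diff_ad_apply: "(f - ad y) x = f x - tbr y (tgen x)"
  by (simp only: minus_apply ad_def)

text \<open>The values of each square derivation lie in its own handle, so the two commute. The
  commutator of a derivation D with ad z is ad (D z), and both derivations kill both handle
  brackets. Only the commutator of ad y and ad z survives.\<close>

lemma der_br_square_der:
  assumes kl: "k \<in> {1..g}" "l \<in> {1..g}" "k \<noteq> l" and x: "x \<in> gens g"
    and y: "y = tsmul c (handle k)" "z = tsmul d (handle l)"
  shows "der_br g (square_der g (dlt (A k)) (dlt (B k)) - ad y) (square_der g (dlt (A l)) (dlt (B l)) - ad z) x =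
    tbr (tbr y z) (tgen x)"
proof -
  let ?P = "square_der g (dlt (A k)) (dlt (B k))" and ?Q = "square_der g (dlt (A l)) (dlt (B l))"
  have ad: "dext g (ad v) (?P x) = tbr v (?P x)" "dext g (ad v) (?Q x) = tbr v (?Q x)"
    "dext g (ad v) (tgen x) = tbr v (tgen x)" for v
    unfolding ad_def by (rule dext_ad[OF LieP_square_der[OF kl(1)]] dext_ad[OF LieP_square_der[OF kl(2)]] dext_ad[OF LieP_tgen[OF x]])+
  have ad_yz: "dext g (ad v) (tbr y (tgen x)) = tbr v (tbr y (tgen x))"
    "dext g (ad v) (tbr z (tgen x)) = tbr v (tbr z (tgen x))" for v
    unfolding ad_def using dext_ad[OF LieP_tbr[OF LieP.smul[OF LieP_handle[OF kl(1)]] LieP_tgen[OF x] refl]]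
      dext_ad[OF LieP_tbr[OF LieP.smul[OF LieP_handle[OF kl(2)]] LieP_tgen[OF x] refl]]
    by (simp_all add: y)
  have PQ: "dext g ?P z = 0" "dext g ?Q y = 0"
    by (simp_all only: y dext_linear dext_square_der_handle[OF kl(1,2)] dext_square_der_handle[OF kl(2,1)] tsmul_simps)
  have PQ': "dext g ?P (tbr z (tgen x)) = tbr z (?P x)" "dext g ?Q (tbr y (tgen x)) = tbr y (?Q x)"
    by (simp_all add: dext_tbr PQ dext_tgen[OF x])
  note rules = diff_ad_apply dext_linear_der dext_linear ad ad_yz PQ' dext_square_der_square_der[OF kl x]
    dext_square_der_square_der[OF kl(2,1) kl(3)[symmetric] x]
  have e1: "dext g (?P - ad y) ((?Q - ad z) x) = - tbr z (?P x) - tbr y (?Q x) + tbr y (tbr z (tgen x))"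
    unfolding rules by (simp add: algebra_simps)
  have e2: "dext g (?Q - ad z) ((?P - ad y) x) = - tbr y (?Q x) - tbr z (?P x) + tbr z (tbr y (tgen x))"
    unfolding rules by (simp add: algebra_simps)
  show ?thesis
    unfolding der_br_def tens_simps e1 e2 jacobi by (simp add: algebra_simps)
qed

text \<open>Each product differs by f1 (f2 - f2') + (f1 - f1') f2', up to exchanging the roles of
  the two. The first part is in the ideal because f1 preserves it, the second because f2' has values
  in L(H). Thus explicit representatives may enter through their values alone.\<close>

lemma der_br_cong:
  assumes "IsDer g m f1" "IsDer g n f2"
    and "dnull g m (f1 - f1')" "dnull g n (f2 - f2')"
    and "\<And>x. x \<in> gens g \<Longrightarrow> LieP g (m + 1) (f1' x)" "\<And>x. x \<in> gens g \<Longrightarrow> LieP g (n + 1) (f2' x)"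
  shows "dnull g (m + n) (der_br g f1 f2 - der_br g f1' f2')"
  unfolding dnull_iff
proof
  fix x assume x: "x \<in> gens g"
  have 1: "IdealP g (n + 1 + m) (dext g f1 (f2 x - f2' x))"
    using assms(4) x by (intro IdealP_dext[OF _ assms(1)]) (auto simp: dnull_iff fun_applies)
  have 2: "IdealP g (m + 1 + n) (dext g f2 (f1 x - f1' x))"
    using assms(3) x by (intro IdealP_dext[OF _ assms(2)]) (auto simp: dnull_iff fun_applies)
  have 3: "IdealP g (n + 1 + m) (dext g (f1 - f1') (f2' x))"
    using assms(3) by (intro IdealP_dext_null[OF assms(6)[OF x]]) (auto simp: dnull_iff)
  have 4: "IdealP g (m + 1 + n) (dext g (f2 - f2') (f1' x))"
    using assms(4) by (intro IdealP_dext_null[OF assms(5)[OF x]]) (auto simp: dnull_iff)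
  have e: "n + 1 + m = m + n + 1" "m + 1 + n = m + n + 1" by simp_all
  have "(der_br g f1 f2 - der_br g f1' f2') x =
      (dext g f1 (f2 x - f2' x) + dext g (f1 - f1') (f2' x)) -
      (dext g f2 (f1 x - f1' x) + dext g (f2 - f2') (f1' x))"
    by (simp add: der_br_def fun_applies dext_linear dext_linear_der)
  then show "IdealP g (m + n + 1) ((der_br g f1 f2 - der_br g f1' f2') x)"
    using 1 2 3 4 unfolding e by (simp only: IdealP_diff IdealP_add)
qed

theorem mainTheorem6:
  fixes g :: nat and U1 U2 :: "(gen \<Rightarrow> tens) set"
    and xi1 xi2 txi1 txi2 :: "gen \<Rightarrow> tens"
  assumes "g \<ge> 3"
    and "highest_weight g 2 U1 lam22"
    and "highest_weight g 2 U2 lam11"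
    and "\<forall>f. IsDer g 2 f \<longrightarrow> (\<exists>u1\<in>U1. \<exists>u2\<in>U2. deq g 2 f (dadd u1 u2))"
    and "\<forall>f\<in>U1 \<inter> U2. dnull g 2 f"
    and "xi1 \<in> U1" and "xi2 \<in> U2"
    and "deq g 2 (phi (A 1) (B 1) (A 1) (B 1)) (dadd xi1 xi2)"
    and "txi1 \<in> U1" and "txi2 \<in> U2"
    and "deq g 2 (phi (A g) (B g) (A g) (B g)) (dadd txi1 txi2)"
  shows "IsDer g 4 (der_br g xi1 txi1) \<and> inner_der g 4 (der_br g xi1 txi1)
         \<and> \<not> dnull g 4 (der_br g xi1 txi1)"
proof -
  interpret der2_split g U1 U2
    using assms(1-5) unfolding highest_weight_def by unfold_locales (auto simp: highest_weight_def)
  have k: "1 \<in> {1..g}" "g \<in> {1..g}" "1 \<noteq> g" using assms(1) by auto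
  let ?P = "square_der g (dlt (A 1)) (dlt (B 1))" and ?Q = "square_der g (dlt (A g)) (dlt (B g))"
  obtain c where c: "c \<noteq> 0" "dnull g 2 (xi1 - (?P - ad (tsmul c (handle 1))))"
    by (rule component[OF k(1) assms(6,7,8)])
  obtain d where d: "d \<noteq> 0" "dnull g 2 (txi1 - (?Q - ad (tsmul d (handle g))))"
    by (rule component[OF k(2) assms(9,10,11)])
  let ?y = "tsmul c (handle 1)" and ?z = "tsmul d (handle g)"
  have der: "IsDer g 2 xi1" "IsDer g 2 txi1"
    using submod_IsDer[OF U1] assms(6,9) by blast+
  have L: "LieP g 2 ?y" "LieP g 2 ?z"
    by (intro LieP.smul LieP_handle k)+
  have "LieP g (2 + 1) ((?P - ad ?y) x)" "LieP g (2 + 1) ((?Q - ad ?z) x)" if "x \<in> gens g" for x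
    unfolding diff_ad_apply using LieP_square_der[OF k(1), of x] LieP_square_der[OF k(2), of x]
      LieP_tbr[OF L(1) LieP_tgen[OF that]] LieP_tbr[OF L(2) LieP_tgen[OF that]]
    by (simp_all add: LieP_diff)
  then have "dnull g (2 + 2) (der_br g xi1 txi1 - der_br g (?P - ad ?y) (?Q - ad ?z))"
    by (intro der_br_cong der c(2) d(2))
  then have I: "IdealP g 5 (der_br g xi1 txi1 x - tbr (tbr ?y ?z) (tgen x))" if "x \<in> gens g" for x
    using that der_br_square_der[OF k that refl refl] by (auto simp: dnull_iff fun_applies)
  have "IsDer g 4 (der_br g xi1 txi1)"
    using IsDer_der_br[OF der] by simp
  moreover have "inner_der g 4 (der_br g xi1 txi1)"
    unfolding inner_der_def deq_def
    using I LieP_tbr[OF L, of 4] by (intro exI[of _ "tbr ?y ?z"]) auto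
  moreover have "\<not> dnull g 4 (der_br g xi1 txi1)"
  proof
    \<comment> \<open>The derivation is tested on b_1, the generator for which
      \<open>bracket_not_IdealP\<close> exhibits a surviving coefficient.\<close>
    have b: "B 1 \<in> gens g" using k by simp
    assume "dnull g 4 (der_br g xi1 txi1)"
    then have "IdealP g 5 (der_br g xi1 txi1 (B 1))"
      using b by (auto simp: dnull_iff)
    from IdealP_diff[OF this I[OF b]] have "IdealP g 5 (tbr (tbr ?y ?z) (tgen (B 1)))"
      by simp
    from IdealP.smul[OF this, of "1 / (c * d)"]
    have "IdealP g 5 (tbr (tbr (handle 1) (handle g)) (tgen (B 1)))"
      using c(1) d(1) by (simp add: tbr_linear tsmul_linear)
    then show False using bracket_not_IdealP[OF assms(1)] by blast
  qed
  ultimately show ?thesis by blast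
qed

end
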